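(* Let $ABC$ be an equilateral triangle and let $N$ be a positive integer. Then $ABC$ can be $N$-tiled in each of the following cases, where $m$ denotes a positive integer: - $N = 3m^2$ and the tile is isosceles with base angles $\pi/6$; - $N = 6m^2$ or $N = 2m^2$, and the tile is a right triangle with $\alpha = \pi/6$; - $N$ is a square and the tile is similar to $ABC$. Moreover, if $T$ is a right triangle whose smallest angle $\alpha$ satisfies $\alpha \neq \pi/6$, then there are no $N$-tilings of $ABC$ by $T$ for any $N$.
   Context: An $N$-tiling of a triangle $ABC$ by a triangle $T$ (the tile) is a set of $N$ triangles $T_1,\dots,T_N$, each congruent to $T$ (reflections allowed), with pairwise disjoint interiors, whose union is the closed triangle $ABC$. Tiles need not meet edge-to-edge. The angles of the tile are denoted $\alpha \le \beta \le \gamma$, so $\alpha$ is the smallest. In the positive statements the shape of the tile is specified and its size is determined by $N$ (its area is $1/N$ times that of $ABC$); the assertion is that an $N$-tiling of $ABC$ by a tile of that shape exists. *)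

theory Defs
  imports "HOL-Analysis.Analysis"
begin

type_synonym point = "real ^ 2"

definition triangle :: "point \<Rightarrow> point \<Rightarrow> point \<Rightarrow> bool" where
  "triangle A B C \<longleftrightarrow> \<not> collinear {A, B, C}"

definition closed_triangle :: "point \<Rightarrow> point \<Rightarrow> point \<Rightarrow> point set" where
  "closed_triangle A B C = convex hull {A, B, C}"

definition equilateral :: "point \<Rightarrow> point \<Rightarrow> point \<Rightarrow> bool" where
  "equilateral A B C \<longleftrightarrow> triangle A B C \<and> dist A B = dist B C \<and> dist B C = dist C A"

text \<open>Unoriented angle at the middle argument \<open>Q\<close>, in \<open>[0, \<pi>]\<close>.
  Only meaningful for \<open>P \<noteq> Q \<noteq> R\<close>.\<close>
definition angle :: "point \<Rightarrow> point \<Rightarrow> point \<Rightarrow> real" where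
  "angle P Q R = arccos (((P - Q) \<bullet> (R - Q)) / (norm (P - Q) * norm (R - Q)))"

text \<open>A self-map of the plane that multiplies all distances by \<open>r > 0\<close> is a Euclidean similarity
  (orientation preserving or reversing); for \<open>r = 1\<close> it is an isometry.\<close>
definition similar_sets :: "point set \<Rightarrow> point set \<Rightarrow> bool" where
  "similar_sets S T \<longleftrightarrow>
     (\<exists>f r. r > 0 \<and> (\<forall>x y. dist (f x) (f y) = r * dist x y) \<and> f ` S = T)"

definition congruent_sets :: "point set \<Rightarrow> point set \<Rightarrow> bool" where
  "congruent_sets S T \<longleftrightarrow> (\<exists>f. (\<forall>x y. dist (f x) (f y) = dist x y) \<and> f ` S = T)"

text \<open>The closed region \<open>T\<close> is a triangle whose angles, in nondecreasing order,
  are \<open>\<alpha>, \<beta>, \<gamma>\<close>. The labelling of the vertices is existentially quantified, so any triangle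
  can be described this way.\<close>
definition tile_angles :: "point set \<Rightarrow> real \<Rightarrow> real \<Rightarrow> real \<Rightarrow> bool" where
  "tile_angles T \<alpha> \<beta> \<gamma> \<longleftrightarrow>
     \<alpha> \<le> \<beta> \<and> \<beta> \<le> \<gamma> \<and>
     (\<exists>P Q R. triangle P Q R \<and> T = closed_triangle P Q R \<and>
        angle Q P R = \<alpha> \<and> angle P Q R = \<beta> \<and> angle P R Q = \<gamma>)"

definition right_tile :: "point set \<Rightarrow> real \<Rightarrow> bool" where
  "right_tile T \<alpha> \<longleftrightarrow> (\<exists>\<beta> \<gamma>. tile_angles T \<alpha> \<beta> \<gamma> \<and> pi / 2 \<in> {\<alpha>, \<beta>, \<gamma>})"

definition isosceles_tile :: "point set \<Rightarrow> real \<Rightarrow> bool" where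
  "isosceles_tile T \<theta> \<longleftrightarrow>
     (\<exists>P Q R. triangle P Q R \<and> T = closed_triangle P Q R \<and> dist P Q = dist P R \<and>
        angle P Q R = \<theta> \<and> angle P R Q = \<theta>)"

text \<open>Tiles are closed regions and need not meet edge-to-edge. Finiteness is stated because
  \<open>card\<close> of an infinite set is \<open>0\<close>.\<close>
definition is_tiling ::
  "point set set \<Rightarrow> nat \<Rightarrow> point \<Rightarrow> point \<Rightarrow> point \<Rightarrow> point set \<Rightarrow> bool" where
  "is_tiling \<T> N A B C T \<longleftrightarrow>
     finite \<T> \<and> card \<T> = N \<and>
     (\<forall>S\<in>\<T>. congruent_sets S T) \<and>
     (\<forall>S\<in>\<T>. \<forall>S'\<in>\<T>. S \<noteq> S' \<longrightarrow> interior S \<inter> interior S' = {}) \<and>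
     \<Union>\<T> = closed_triangle A B C"

definition can_be_tiled :: "nat \<Rightarrow> point \<Rightarrow> point \<Rightarrow> point \<Rightarrow> point set \<Rightarrow> bool" where
  "can_be_tiled N A B C T \<longleftrightarrow> (\<exists>\<T>. is_tiling \<T> N A B C T)"

end

theory Submission
  imports Defs
begin

text \<open>
  The positive cases all refine the grid of \<open>m\<^sup>2\<close> equilateral triangles: joining the vertices to the
  centroid gives the isosceles tile, and halving a grid triangle or an isosceles tile along its axis gives
  the right tile.

  For the nonexistence part let \<open>\<beta> = \<pi>/2 - \<alpha>\<close> and count the angles of the tiles meeting at a point. The corner
  condition \<open>\<pi>/3 = p \<alpha> + q \<beta>\<close> has no solution if \<open>\<pi>/6 < \<alpha> \<le> \<pi>/4\<close>. If \<open>\<alpha> < \<pi>/6\<close>, then \<open>\<beta> > \<pi>/3\<close>, so only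
  angles \<open>\<alpha>\<close> occur at the corners, say \<open>p\<close> of them, and \<open>\<alpha> = \<pi>/(3p)\<close>. As \<open>\<alpha>\<close> and \<open>\<beta>\<close> occur equally
  often in total, some other point has more angles \<open>\<beta>\<close> than \<open>\<alpha>\<close>. Since these angles, right angles and
  straight angles add up to at most \<open>2\<pi>\<close>, this gives \<open>s \<beta> = i \<pi>/2\<close> with \<open>s \<ge> 1\<close> and \<open>i \<le> 4\<close>, hence
  \<open>\<alpha> = \<pi>/8\<close> or \<open>\<alpha> = \<pi>/10\<close>, neither of which is of the form \<open>\<pi>/(3p)\<close>.

  The local angle of a region \<open>S\<close> at \<open>x\<close> is read off from the area of \<open>S \<inter> ball x r\<close> for small \<open>r\<close>. It is
  additive over tiles because convex sets with disjoint interiors overlap in a null set.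
\<close>

section \<open>Triangles and isometries of the plane\<close>

lemma vec2_eq_iff: "x = y \<longleftrightarrow> x $ 1 = y $ 1 \<and> x $ 2 = y $ 2" for x y :: "'a ^ 2"
  by (simp add: vec_eq_iff forall_2)

lemma inner_vec2: "x \<bullet> y = x $ 1 * y $ 1 + x $ 2 * y $ 2" for x y :: point
  by (simp add: inner_vec_def sum_2)

text \<open>Collinearity is the equality case of the Cauchy-Schwarz inequality. Squaring removes
  norms and absolute values, so that isometries and scalings preserve triangles by mere rewriting of
  inner products.\<close>

lemma triangle_iff_inner:
  "triangle A B C \<longleftrightarrow>
     ((B - A) \<bullet> (C - A))\<^sup>2 \<noteq> ((B - A) \<bullet> (B - A)) * ((C - A) \<bullet> (C - A))"
proof -
  have "collinear {A, B, C} \<longleftrightarrow> collinear {B, A, C}"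
    by (simp add: insert_commute)
  also have "\<dots> \<longleftrightarrow> collinear {0, B - A, C - A}"
    by (rule collinear_3) simp
  also have "\<dots> \<longleftrightarrow> \<bar>(B - A) \<bullet> (C - A)\<bar> = norm (B - A) * norm (C - A)"
    by (rule norm_cauchy_schwarz_equal [symmetric])
  also have "\<dots> \<longleftrightarrow> ((B - A) \<bullet> (C - A))\<^sup>2 = (norm (B - A) * norm (C - A))\<^sup>2"
    by (metis abs_ge_zero norm_ge_zero mult_nonneg_nonneg power2_abs power2_eq_iff_nonneg)
  finally show ?thesis
    by (simp add: triangle_def power_mult_distrib dot_square_norm)
qed

text \<open>Cramer's rule: \<open>b\<close> and \<open>c\<close> are the edges \<open>C - A\<close>
  and \<open>B - A\<close> turned by a right angle and divided by their determinant. Thus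
  \<open>b \<bullet> (x - A)\<close> and \<open>c \<bullet> (x - A)\<close> are the barycentric
  coordinates of \<open>x\<close> at \<open>B\<close> and \<open>C\<close>; most later computations
  with triangles run in these coordinates.\<close>

lemma triangle_dual_basis:
  assumes "triangle A B C"
  obtains b c :: point where
    "b \<bullet> (B - A) = 1" "b \<bullet> (C - A) = 0" "c \<bullet> (B - A) = 0" "c \<bullet> (C - A) = 1"
    "\<And>x. x = (b \<bullet> x) *\<^sub>R (B - A) + (c \<bullet> x) *\<^sub>R (C - A)"
proof -
  define u v where "u = B - A" and "v = C - A"
  define d where "d = u $ 1 * v $ 2 - u $ 2 * v $ 1"
  \<comment> \<open>Lagrange's identity: the square of the determinant is the Gram determinant,
    which is nonzero for a triangle.\<close>
  have "d\<^sup>2 = (u \<bullet> u) * (v \<bullet> v) - (u \<bullet> v)\<^sup>2"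
    by (simp add: d_def inner_vec2 power2_eq_square algebra_simps)
  with assms have d: "d \<noteq> 0"
    by (auto simp: triangle_iff_inner u_def v_def)
  define b c :: point where "b = vector [v $ 2 / d, - v $ 1 / d]" and "c = vector [- u $ 2 / d, u $ 1 / d]"
  have "b \<bullet> u = d / d" "b \<bullet> v = 0" "c \<bullet> u = 0" "c \<bullet> v = d / d"
    by (simp_all add: b_def c_def d_def inner_vec2 diff_divide_distrib field_simps)
  moreover have "x = (b \<bullet> x) *\<^sub>R u + (c \<bullet> x) *\<^sub>R v" for x
  proof -
    have bx: "b \<bullet> x = (v $ 2 * x $ 1 - v $ 1 * x $ 2) / d"
      and cx: "c \<bullet> x = (u $ 1 * x $ 2 - u $ 2 * x $ 1) / d"
      by (simp_all add: b_def c_def inner_vec2 diff_divide_distrib)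
    have "(b \<bullet> x) * u $ 1 + (c \<bullet> x) * v $ 1 = x $ 1"
      "(b \<bullet> x) * u $ 2 + (c \<bullet> x) * v $ 2 = x $ 2"
      using d unfolding bx cx by (simp_all add: divide_simps) (simp_all add: d_def algebra_simps)
    then show ?thesis
      by (simp add: vec2_eq_iff)
  qed
  ultimately show ?thesis using d that [of b c]
    by (simp add: u_def v_def)
qed

text \<open>The hull becomes an intersection of three half-planes, which shows what the triangle
  looks like near a given point.\<close>

lemma closed_triangle_dual_basis:
  assumes "b \<bullet> (B - A) = 1" "b \<bullet> (C - A) = 0" "c \<bullet> (B - A) = 0" "c \<bullet> (C - A) = 1"
    "\<And>x. x = (b \<bullet> x) *\<^sub>R (B - A) + (c \<bullet> x) *\<^sub>R (C - A)"
  shows "closed_triangle A B C =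
    {x. 0 \<le> b \<bullet> (x - A) \<and> 0 \<le> c \<bullet> (x - A) \<and> b \<bullet> (x - A) + c \<bullet> (x - A) \<le> 1}"
    (is "_ = ?R")
proof (intro equalityI subsetI)
  fix x assume "x \<in> closed_triangle A B C"
  then obtain s t where "x = A + s *\<^sub>R (B - A) + t *\<^sub>R (C - A)" "0 \<le> s" "0 \<le> t" "s + t \<le> 1"
    by (auto simp: closed_triangle_def convex_hull_3_alt)
  then have "x - A = s *\<^sub>R (B - A) + t *\<^sub>R (C - A)" "0 \<le> s" "0 \<le> t" "s + t \<le> 1" by auto
  then show "x \<in> ?R"
    by (simp add: inner_right_distrib assms(1-4))
next
  fix x assume "x \<in> ?R"
  moreover have "x = A + (b \<bullet> (x - A)) *\<^sub>R (B - A) + (c \<bullet> (x - A)) *\<^sub>R (C - A)"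
    using assms(5) [of "x - A"] by (simp add: algebra_simps)
  ultimately show "x \<in> closed_triangle A B C"
    unfolding closed_triangle_def convex_hull_3_alt by blast
qed

lemma triangle_permute:
  assumes "triangle A B C" shows "triangle B C A" "triangle A C B"
  using assms by (simp_all add: triangle_def insert_commute)

lemma triangle_distinct: "triangle A B C \<Longrightarrow> A \<noteq> B \<and> B \<noteq> C \<and> A \<noteq> C"
  by (auto simp: triangle_def insert_commute)

lemma closed_triangle_permute: "closed_triangle A B C = closed_triangle B C A"
    "closed_triangle A B C = closed_triangle A C B"
  by (simp_all add: closed_triangle_def insert_commute)

section \<open>Isometries acting on triangles, angles and interiors\<close>

lemma isometry_affine:
  fixes f :: "point \<Rightarrow> point"
  assumes "\<And>x y. dist (f x) (f y) = dist x y"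
  obtains h a where "orthogonal_transformation h" "f = (+) a \<circ> h"
proof
  show "orthogonal_transformation (\<lambda>x. f x - f 0)"
    using assms by (simp add: orthogonal_transformation_isometry dist_norm)
  show "f = (+) (f 0) \<circ> (\<lambda>x. f x - f 0)"
    by auto
qed

text \<open>Congruence only asks for a map that preserves distances. Such a map is an orthogonal map
  followed by a translation, hence bijective and affine, and therefore compatible with hulls and
  interiors.\<close>

lemma isometry_properties:
  fixes f :: "point \<Rightarrow> point"
  assumes "\<And>x y. dist (f x) (f y) = dist x y"
  shows "bij f" "f ` (convex hull S) = convex hull (f ` S)" "interior (f ` S) = f ` interior S"
proof -
  obtain h a where h: "orthogonal_transformation h" and f: "f = (+) a \<circ> h"
    using isometry_affine assms by metis
  have lin: "linear h" and bij: "bij h"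
    using h by (auto intro: orthogonal_transformation_linear orthogonal_transformation_bij)
  show "bij f" unfolding f using bij by (intro bij_comp) (simp_all add: bij_is_surj)
  show "f ` (convex hull S) = convex hull (f ` S)"
    unfolding f image_comp [symmetric] convex_hull_linear_image [OF lin] convex_hull_translation ..
  show "interior (f ` S) = f ` interior S"
    unfolding f image_comp [symmetric] interior_translation interior_bijective_linear_image [OF lin bij] ..
qed

lemma isometry_closed_triangle:
  assumes "\<And>x y. dist (f x) (f y) = dist x y"
  shows "f ` closed_triangle A B C = closed_triangle (f A) (f B) (f C)"
  by (simp add: closed_triangle_def isometry_properties [OF assms])

lemma isometry_inv:
  fixes f :: "point \<Rightarrow> point"
  assumes "\<And>x y. dist (f x) (f y) = dist x y"
  shows "dist (inv f x) (inv f y) = dist x y"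
  by (metis assms bij_inv_eq_iff isometry_properties(1) [OF assms])

lemma isometry_inner:
  fixes f :: "point \<Rightarrow> point"
  assumes "\<And>x y. dist (f x) (f y) = dist x y"
  shows "(f B - f A) \<bullet> (f C - f A) = (B - A) \<bullet> (C - A)"
proof -
  obtain h a where h: "orthogonal_transformation h" and f: "f = (+) a \<circ> h"
    using isometry_affine assms by metis
  have "h B - h A = h (B - A)" "h C - h A = h (C - A)"
    using linear_diff [OF orthogonal_transformation_linear [OF h]] by simp_all
  with h show ?thesis by (simp add: f orthogonal_transformation_def)
qed

lemma congruent_sets_sym:
  assumes "congruent_sets S T" shows "congruent_sets T S"
proof -
  obtain f where f: "\<And>x y. dist (f x) (f y) = dist x y" and T: "T = f ` S"
    using assms by (auto simp: congruent_sets_def)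
  have "inv f ` T = S"
    using isometry_properties(1) [OF f] by (simp add: T bij_is_inj image_inv_f_f)
  with isometry_inv [OF f] show ?thesis
    unfolding congruent_sets_def by blast
qed

lemma congruent_sets_trans:
  assumes "congruent_sets S T" "congruent_sets T U" shows "congruent_sets S U"
proof -
  obtain f g where "\<And>x y. dist (f x) (f y) = dist x y" "T = f ` S"
    "\<And>x y. dist (g x) (g y) = dist x y" "U = g ` T"
    using assms unfolding congruent_sets_def by metis
  then show ?thesis
    unfolding congruent_sets_def by (intro exI [of _ "g \<circ> f"]) (auto simp: image_comp)
qed

text \<open>Transports the labelled vertices along the isometry, so that every tile of a tiling can
  be labelled in the same way as the given tile.\<close>

lemma congruent_closed_triangle:
  assumes "congruent_sets S (closed_triangle P Q R)" "triangle P Q R"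
  obtains P' Q' R' where "triangle P' Q' R'" "S = closed_triangle P' Q' R'"
    "angle Q' P' R' = angle Q P R" "angle P' Q' R' = angle P Q R" "angle P' R' Q' = angle P R Q"
proof -
  from congruent_sets_sym [OF assms(1)] obtain f where
    f: "\<And>x y. dist (f x) (f y) = dist x y" and S: "S = f ` closed_triangle P Q R"
    by (auto simp: congruent_sets_def)
  note i = isometry_inner [OF f]
  have n: "norm (f x - f y) = norm (x - y)" for x y
    using f [of x y] by (simp add: dist_norm)
  have "triangle (f P) (f Q) (f R)"
    using assms(2) by (simp add: triangle_iff_inner i)
  moreover have "S = closed_triangle (f P) (f Q) (f R)"
    using S isometry_closed_triangle [OF f] by simp
  ultimately show ?thesis
    by (rule that) (simp_all add: angle_def i n)
qed

text \<open>The interior of a closed half-plane is the open one. All disjointness claims about the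
  explicit pieces come from such a separating line with normal \<open>n\<close>.\<close>

lemma interiors_separated:
  fixes S T :: "point set"
  assumes "n \<noteq> 0" "S \<subseteq> {x. n \<bullet> x \<le> k}" "T \<subseteq> {x. k \<le> n \<bullet> x}"
  shows "interior S \<inter> interior T = {}"
proof -
  have "interior S \<subseteq> {x. n \<bullet> x < k}" "interior T \<subseteq> {x. k < n \<bullet> x}"
    using interior_mono [OF assms(2)] interior_mono [OF assms(3)] assms(1) by simp_all
  then show ?thesis by fastforce
qed

lemma interior_closed_triangle_nonempty:
  assumes "triangle A B C" shows "interior (closed_triangle A B C) \<noteq> {}"
proof -
  obtain b c where bc: "b \<bullet> (B - A) = 1" "b \<bullet> (C - A) = 0" "c \<bullet> (B - A) = 0" "c \<bullet> (C - A) = 1"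
    "\<And>x. x = (b \<bullet> x) *\<^sub>R (B - A) + (c \<bullet> x) *\<^sub>R (C - A)"
    using triangle_dual_basis [OF assms] by metis
  define U where "U = {x. 0 < b \<bullet> (x - A) \<and> 0 < c \<bullet> (x - A) \<and> b \<bullet> (x - A) + c \<bullet> (x - A) < 1}"
  have "open U"
    unfolding U_def by (intro open_Collect_conj open_Collect_less continuous_intros)
  moreover have "U \<subseteq> closed_triangle A B C"
    unfolding closed_triangle_dual_basis [OF bc] U_def by auto
  moreover have "A + (1/3) *\<^sub>R (B - A) + (1/3) *\<^sub>R (C - A) \<in> U"
    using bc(1-4) by (simp add: U_def inner_right_distrib)
  ultimately show ?thesis
    using interior_maximal by blast
qed

section \<open>Local angles as area densities\<close>

definition unit_dir :: "real \<Rightarrow> point" where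
  "unit_dir t = cos t *\<^sub>R axis 1 1 + sin t *\<^sub>R axis 2 1"

lemma unit_dir_nth [simp]: "unit_dir t $ 1 = cos t" "unit_dir t $ 2 = sin t"
  by (simp_all add: unit_dir_def axis_def)

lemma inner_unit_dir: "unit_dir s \<bullet> unit_dir t = cos (t - s)"
  by (simp add: inner_vec2 cos_diff mult.commute)

lemma norm_unit_dir [simp]: "norm (unit_dir t) = 1"
  by (simp add: norm_eq_sqrt_inner inner_unit_dir)

text \<open>The free start \<open>a\<close> of the window allows polar angles to be measured from a
  chosen ray.\<close>

lemma polar_form:
  fixes u :: point
  obtains t where "a \<le> t" "t < a + 2 * pi" "u = norm u *\<^sub>R unit_dir t"
proof (cases "u = 0")
  case True
  then show ?thesis using that [of a] by simp
next
  case False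
  have "(u $ 1)\<^sup>2 + (u $ 2)\<^sup>2 = (norm u)\<^sup>2"
    by (simp add: norm_eq_sqrt_inner inner_vec2 power2_eq_square)
  then have "(u $ 1 / norm u)\<^sup>2 + (u $ 2 / norm u)\<^sup>2 = 1"
    using False by (simp add: power_divide add_divide_distrib [symmetric])
  then obtain t0 where t0: "u $ 1 / norm u = cos t0" "u $ 2 / norm u = sin t0"
    by (rule sincos_total_2pi)
  \<comment> \<open>The number of full turns to remove in order to land in the window starting at
    \<open>a\<close>.\<close>
  define k where "k = \<lfloor>(t0 - a) / (2 * pi)\<rfloor>"
  define t where "t = t0 - 2 * pi * of_int k"
  have "sin t0 = sin t \<and> cos t0 = cos t"
    unfolding sin_cos_eq_iff by (rule exI [of _ k]) (simp add: t_def)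
  moreover have "u $ 1 = norm u * cos t0" "u $ 2 = norm u * sin t0"
    unfolding t0 [symmetric] using False by simp_all
  ultimately have "u = norm u *\<^sub>R unit_dir t"
    unfolding vec2_eq_iff by simp
  moreover have "of_int k \<le> (t0 - a) / (2 * pi) \<and> (t0 - a) / (2 * pi) < of_int k + 1"
    using floor_correct [of "(t0 - a) / (2 * pi)"] by (simp only: k_def of_int_add of_int_1)
  then have "of_int k * (2 * pi) \<le> t0 - a \<and> t0 - a < (of_int k + 1) * (2 * pi)"
    by (simp only: pos_le_divide_eq pos_divide_less_eq pi_gt_zero mult_pos_pos zero_less_numeral)
  then have "a \<le> t" "t < a + 2 * pi"
    unfolding t_def by (simp_all only: distrib_right) argo+
  ultimately show ?thesis using that by blast
qed

text \<open>Norms determine the radius. Equal directions differ by a multiple of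
  \<open>2 * pi\<close>, and the bound leaves only zero. This makes the parametrisation of a sector
  injective.\<close>

lemma polar_eqD:
  assumes "\<rho> *\<^sub>R unit_dir \<phi> = \<rho>' *\<^sub>R unit_dir \<phi>'" "0 < \<rho>" "0 < \<rho>'" "\<bar>\<phi> - \<phi>'\<bar> < 2 * pi"
  shows "\<rho> = \<rho>' \<and> \<phi> = \<phi>'"
proof -
  have "\<rho> = \<rho>'"
    using arg_cong [OF assms(1), of norm] assms(2,3) by simp
  then have "unit_dir \<phi> = unit_dir \<phi>'"
    using assms by simp
  then have "cos (\<phi>' - \<phi>) = 1"
    by (metis inner_unit_dir cos_zero diff_self)
  then obtain n :: int where n: "\<phi>' - \<phi> = of_int n * (2 * pi)"
    using cos_one_2pi_int by (metis mult.assoc)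
  then have "\<bar>of_int n * (2 * pi)\<bar> < 2 * pi"
    using assms(4) by (simp only: abs_minus_commute [of \<phi>])
  then have "\<bar>of_int n :: real\<bar> < 1"
    by (simp add: abs_mult)
  then have "n = 0" by linarith
  with n \<open>\<rho> = \<rho>'\<close> show ?thesis by simp
qed

text \<open>Parametrising by the squared radius makes the Jacobian constant.\<close>

lemma sector_area:
  assumes "0 < r" "s < t" "t - s \<le> 2 * pi"
  defines "S \<equiv> {\<rho> *\<^sub>R unit_dir \<phi> | \<rho> \<phi>. 0 < \<rho> \<and> \<rho> < r \<and> s < \<phi> \<and> \<phi> < t}"
  shows "S \<in> lmeasurable \<and> measure lebesgue S = (t - s) / 2 * r\<^sup>2"
proof -
  define F :: "point \<Rightarrow> point" where "F q = sqrt (q $ 1) *\<^sub>R unit_dir (q $ 2)" for q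
  define F' :: "point \<Rightarrow> point \<Rightarrow> point" where
    "F' q h = (h $ 1 / (2 * sqrt (q $ 1))) *\<^sub>R unit_dir (q $ 2)
       + (sqrt (q $ 1) * h $ 2) *\<^sub>R (- sin (q $ 2) *\<^sub>R axis 1 1 + cos (q $ 2) *\<^sub>R axis 2 1)" for q h
  define B :: "point set" where "B = box (vector [0, s]) (vector [r\<^sup>2, t])"
  have B: "q \<in> B \<longleftrightarrow> 0 < q $ 1 \<and> q $ 1 < r\<^sup>2 \<and> s < q $ 2 \<and> q $ 2 < t" for q
    by (auto simp: B_def mem_box_cart forall_2)
  have "B \<in> sets lebesgue"
    by (simp add: B_def)
  have "F ` B = S"
  proof (intro equalityI subsetI)
    fix x assume "x \<in> F ` B"
    then obtain q where q: "q \<in> B" "x = sqrt (q $ 1) *\<^sub>R unit_dir (q $ 2)"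
      by (auto simp: F_def)
    moreover have "sqrt (q $ 1) < r"
      using q(1) assms(1) unfolding B by (intro real_less_lsqrt) auto
    ultimately show "x \<in> S"
      unfolding S_def B by force
  next
    fix x assume "x \<in> S"
    then obtain \<rho> \<phi> where x: "x = \<rho> *\<^sub>R unit_dir \<phi>" "0 < \<rho>" "\<rho> < r" "s < \<phi>" "\<phi> < t"
      by (auto simp: S_def)
    then have "vector [\<rho>\<^sup>2, \<phi>] \<in> B" "F (vector [\<rho>\<^sup>2, \<phi>]) = x"
      by (auto simp: B F_def power_strict_mono)
    then show "x \<in> F ` B" by blast
  qed
  moreover have "(F has_derivative F' q) (at q within B)" if "q \<in> B" for q
  proof -
    have [derivative_intros]: "((\<lambda>q. q $ i) has_derivative (\<lambda>h. h $ i)) (at q within B)" for i :: 2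
      by (intro bounded_linear_imp_has_derivative bounded_linear_vec_nth)
    show ?thesis
      using that unfolding F_def [abs_def] F'_def [abs_def] unit_dir_def B
      by (auto intro!: derivative_eq_intros simp: vec2_eq_iff axis_def field_simps)
  qed
  \<comment> \<open>The angles in \<open>B\<close> range over an open interval, so two of them
    differ by less than \<open>2 * pi\<close> even if the sector is a slit disc.\<close>
  moreover have "inj_on F B"
  proof (rule inj_onI)
    fix p q assume pq: "p \<in> B" "q \<in> B" "F p = F q"
    have "sqrt (p $ 1) = sqrt (q $ 1) \<and> p $ 2 = q $ 2"
      using pq assms(3) unfolding B F_def by (intro polar_eqD) auto
    then show "p = q" by (simp add: vec2_eq_iff)
  qed
  moreover have "((\<lambda>q. \<bar>det (matrix (F' q))\<bar>) has_integral (t - s) / 2 * r\<^sup>2) B"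
  proof -
    \<comment> \<open>The two columns are orthogonal, of lengths
      \<open>1 / (2 * sqrt (q $ 1))\<close> and \<open>sqrt (q $ 1)\<close>.\<close>
    have det: "\<bar>det (matrix (F' q))\<bar> = 1 / 2" if "q \<in> B" for q
    proof -
      have "det (matrix (F' q)) = ((cos (q $ 2))\<^sup>2 + (sin (q $ 2))\<^sup>2) / 2"
        using that unfolding B
        by (simp add: det_2 matrix_def F'_def axis_def field_simps power2_eq_square)
      then show ?thesis by simp
    qed
    have "((\<lambda>q. 1 / 2 :: real) has_integral (t - s) / 2 * r\<^sup>2) B"
    proof -
      let ?a = "vector [0, s] :: point" and ?b = "vector [r\<^sup>2, t] :: point"
      have "cbox ?a ?b \<noteq> {}"
        using assms by (simp add: interval_ne_empty_cart forall_2)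
      then have "measure lborel (cbox ?a ?b) = r\<^sup>2 * (t - s)"
        by (simp add: content_cbox_cart UNIV_2)
      then show ?thesis
        using has_integral_const [of "1 / 2 :: real" ?a ?b]
        by (simp add: B_def has_integral_open_interval mult.commute)
    qed
    then show ?thesis
      by (rule has_integral_eq [rotated]) (rule det [symmetric])
  qed
  ultimately show ?thesis
    using has_measure_differentiable_image [of B F F' "(t - s) / 2 * r\<^sup>2"] \<open>B \<in> sets lebesgue\<close> by blast
qed


text \<open>A sector of opening \<open>w\<close> and radius \<open>r\<close> has area
  \<open>w / 2 * r\<^sup>2\<close>. This is a relation rather than a function because a general set
  need not have a local angle.\<close>

definition has_angle_at :: "point set \<Rightarrow> point \<Rightarrow> real \<Rightarrow> bool" where
  "has_angle_at S x w \<longleftrightarrow>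
     (\<forall>\<^sub>F r in at_right 0. measure lebesgue (S \<inter> ball x r) = w / 2 * r\<^sup>2)"

lemma has_angle_at_unique:
  assumes "has_angle_at S x w" "has_angle_at S x w'"
  shows "w = w'"
proof -
  have "\<forall>\<^sub>F r :: real in at_right 0. 0 < r"
    by (simp add: eventually_at_right_less)
  with assms have "\<forall>\<^sub>F r :: real in at_right 0. w = w'"
    unfolding has_angle_at_def by eventually_elim simp
  then show ?thesis by simp
qed

text \<open>The density depends only on the set near \<open>x\<close>. Hence a triangle may be
  replaced by a cone, a half-plane, the plane or the empty set, according to the position of
  \<open>x\<close>.\<close>

lemma has_angle_at_local:
  assumes "open U" "x \<in> U" "\<And>y. y \<in> U \<Longrightarrow> y \<in> S \<longleftrightarrow> y \<in> S'" "has_angle_at S' x w"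
  shows "has_angle_at S x w"
proof -
  obtain e where "e > 0" and e: "ball x e \<subseteq> U"
    using assms(1,2) openE by blast
  have "S \<inter> ball x r = S' \<inter> ball x r" if "r < e" for r
  proof -
    have "ball x r \<subseteq> U"
      using that e subset_ball [of r e x] by (meson less_imp_le subset_trans)
    then show ?thesis using assms(3) by blast
  qed
  moreover have "\<forall>\<^sub>F r in at_right 0. r < e"
    using \<open>e > 0\<close> unfolding eventually_at_right_field by blast
  ultimately show ?thesis
    using assms(4) unfolding has_angle_at_def by (auto elim: eventually_elim2)
qed

lemma has_angle_at_empty: "has_angle_at {} x 0"
  by (simp add: has_angle_at_def)

lemma has_angle_at_UNIV: "has_angle_at UNIV x (2 * pi)"
  unfolding has_angle_at_def
  by (rule eventually_mono [OF eventually_at_right_less]) (simp add: circle_area)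

text \<open>The point reflection through \<open>x\<close> exchanges the two half-discs.\<close>

lemma has_angle_at_halfplane:
  assumes "n \<noteq> 0" shows "has_angle_at {y. 0 \<le> n \<bullet> (y - x)} x pi"
  unfolding has_angle_at_def
proof (rule eventually_mono [OF eventually_at_right_less])
  fix r :: real assume r: "0 < r"
  define H where "H = {y. 0 \<le> n \<bullet> (y - x)} \<inter> ball x r"
  define K where "K = {y. n \<bullet> (y - x) \<le> 0} \<inter> ball x r"
  have meas: "H \<in> lmeasurable" "K \<in> lmeasurable"
    unfolding H_def K_def
    using convex_halfspace_ge [of "n \<bullet> x" n] convex_halfspace_le [of n "n \<bullet> x"]
    by (auto simp: inner_diff_right intro!: measurable_convex convex_Int bounded_Int)
  have [simp]: "n \<bullet> (2 * x) = 2 * (n \<bullet> x)"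
    by (metis inner_add_right mult_2)
  have "K = (\<lambda>y. x + x - y) ` H"
  proof (intro equalityI subsetI)
    fix y assume "y \<in> K"
    then have "x + x - y \<in> H"
      by (auto simp: H_def K_def dist_norm inner_diff_right inner_add_right norm_minus_commute)
    then show "y \<in> (\<lambda>y. x + x - y) ` H"
      by (rule rev_image_eqI) simp
  next
    fix y assume "y \<in> (\<lambda>y. x + x - y) ` H"
    then show "y \<in> K"
      by (auto simp: H_def K_def dist_norm inner_diff_right inner_add_right norm_minus_commute)
  qed
  also have "\<dots> = (+) (x + x) ` (uminus ` H)"
    by (simp add: image_image)
  finally have "measure lebesgue K = measure lebesgue H"
    using measure_orthogonal_image [of uminus H] meas
    by (simp add: measure_translation orthogonal_transformation_def linear_uminus)
  moreover have "negligible (H \<inter> K)"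
  proof (rule negligible_subset)
    show "negligible {y. n \<bullet> y = n \<bullet> x}"
      using assms by (simp add: negligible_hyperplane)
    show "H \<inter> K \<subseteq> {y. n \<bullet> y = n \<bullet> x}"
      by (auto simp: H_def K_def inner_diff_right)
  qed
  moreover have "H \<union> K = ball x r"
    by (auto simp: H_def K_def)
  ultimately have "pi * r\<^sup>2 = measure lebesgue H + measure lebesgue H"
    using measure_Un3 [OF meas] negligible_imp_measure0 [of "H \<inter> K"] circle_area [of r x] r
    by (simp add: mult.commute)
  then show "measure lebesgue (H) = pi / 2 * r\<^sup>2" by simp
qed

lemma has_angle_at_Union:
  fixes w :: "point set \<Rightarrow> real"
  assumes "finite \<T>" "\<And>S. S \<in> \<T> \<Longrightarrow> has_angle_at S x (w S)"
    "\<And>S. S \<in> \<T> \<Longrightarrow> convex S"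
    "\<And>S S'. S \<in> \<T> \<Longrightarrow> S' \<in> \<T> \<Longrightarrow> S \<noteq> S' \<Longrightarrow> interior S \<inter> interior S' = {}"
  shows "has_angle_at (\<Union>\<T>) x (\<Sum>S\<in>\<T>. w S)"
proof -
  \<comment> \<open>As there are finitely many tiles, one bound on the radius works for all of
    them.\<close>
  have near: "\<forall>\<^sub>F r in at_right 0. \<forall>S\<in>\<T>. measure lebesgue (S \<inter> ball x r) = w S / 2 * r\<^sup>2"
    using assms(1,2) by (simp add: eventually_ball_finite_distrib has_angle_at_def)
  have Union: "measure lebesgue (\<Union>\<T> \<inter> ball x r) = (\<Sum>S\<in>\<T>. measure lebesgue (S \<inter> ball x r))" for r
  proof -
    have "negligible (S \<inter> ball x r \<inter> (S' \<inter> ball x r))" if "S \<in> \<T>" "S' \<in> \<T>" "S \<noteq> S'" for S S'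
    proof (rule negligible_subset)
      show "negligible (S \<inter> S')"
        using assms(3,4) that by (simp add: negligible_convex_interior convex_Int)
    qed auto
    then have "measure lebesgue (\<Union>((\<lambda>S. S \<inter> ball x r) ` \<T>)) = (\<Sum>S\<in>\<T>. measure lebesgue (S \<inter> ball x r))"
      using assms(1,3)
      by (intro measure_negligible_finite_Union_image)
        (auto simp: pairwise_def intro!: measurable_convex convex_Int bounded_Int)
    then show ?thesis by (simp only: Int_Union2)
  qed
  show ?thesis
    unfolding has_angle_at_def
  proof (rule eventually_mono [OF near])
    fix r assume "\<forall>S\<in>\<T>. measure lebesgue (S \<inter> ball x r) = w S / 2 * r\<^sup>2"
    then show "measure lebesgue (\<Union>\<T> \<inter> ball x r) = (\<Sum>S\<in>\<T>. w S) / 2 * r\<^sup>2"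
      unfolding Union sum_divide_distrib sum_distrib_right by (intro sum.cong) auto
  qed
qed

section \<open>Local angles of a triangle at its vertices and elsewhere\<close>

lemma has_angle_at_cone_oriented:
  assumes "triangle A B C" "B - A = p *\<^sub>R unit_dir s" "C - A = q *\<^sub>R unit_dir t"
    "0 < p" "0 < q" "s < t" "t < s + pi"
    and decomp: "\<And>y. y = (b \<bullet> y) *\<^sub>R (B - A) + (c \<bullet> y) *\<^sub>R (C - A)"
    and nz: "b \<noteq> 0" "c \<noteq> 0"
  shows "has_angle_at {x. 0 \<le> b \<bullet> (x - A) \<and> 0 \<le> c \<bullet> (x - A)} A (angle B A C)"
proof -
  have "(B - A) \<bullet> (C - A) / (norm (B - A) * norm (C - A)) = cos (t - s)"
    using assms(2-5) by (simp add: inner_unit_dir)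
  then have angle: "angle B A C = t - s"
    using assms(6,7) by (simp add: angle_def arccos_cos)
  have sin_pos: "0 < sin (t - s)"
    using assms(6,7) by (intro sin_gt_zero) auto
  have "measure lebesgue ({x. 0 \<le> b \<bullet> (x - A) \<and> 0 \<le> c \<bullet> (x - A)} \<inter> ball A r) = (t - s) / 2 * r\<^sup>2"
    if r: "0 < r" for r
  proof -
    \<comment> \<open>The open sector swept from the direction of \<open>B - A\<close> to that of
      \<open>C - A\<close>. Its translate to \<open>A\<close> will agree with the cone in the disc,
      up to the two bounding lines.\<close>
    define S where "S = {\<rho> *\<^sub>R unit_dir \<phi> | \<rho> \<phi>. 0 < \<rho> \<and> \<rho> < r \<and> s < \<phi> \<and> \<phi> < t}"
    have S: "S \<in> lmeasurable \<and> measure lebesgue S = (t - s) / 2 * r\<^sup>2"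
      using sector_area [OF r, of s t] assms(6,7) by (simp add: S_def)
    \<comment> \<open>Cross products of \<open>y\<close> with the two edge directions isolate one
      coordinate each, so the signs of the coordinates are those of the sines.\<close>
    have cross: "\<rho> * sin (t - \<phi>) = (b \<bullet> y) * p * sin (t - s)"
      "\<rho> * sin (\<phi> - s) = (c \<bullet> y) * q * sin (t - s)" if "y = \<rho> *\<^sub>R unit_dir \<phi>" for y \<rho> \<phi>
    proof -
      have "y $ 1 = (b \<bullet> y) * p * cos s + (c \<bullet> y) * q * cos t"
        "y $ 2 = (b \<bullet> y) * p * sin s + (c \<bullet> y) * q * sin t"
        using arg_cong [OF decomp [of y], of "\<lambda>v. v $ 1"] arg_cong [OF decomp [of y], of "\<lambda>v. v $ 2"]
        by (simp_all add: assms(2,3))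
      moreover have "y $ 1 = \<rho> * cos \<phi>" "y $ 2 = \<rho> * sin \<phi>"
        using that by simp_all
      ultimately have "\<rho> * cos \<phi> = (b \<bullet> y) * p * cos s + (c \<bullet> y) * q * cos t"
        "\<rho> * sin \<phi> = (b \<bullet> y) * p * sin s + (c \<bullet> y) * q * sin t"
        by simp_all
      then show "\<rho> * sin (t - \<phi>) = (b \<bullet> y) * p * sin (t - s)"
        "\<rho> * sin (\<phi> - s) = (c \<bullet> y) * q * sin (t - s)"
        unfolding sin_diff by algebra+
    qed
    have S_iff: "y \<in> S \<longleftrightarrow> 0 < b \<bullet> y \<and> 0 < c \<bullet> y \<and> norm y < r" for y
    proof
      assume "y \<in> S"
      then obtain \<rho> \<phi> where y: "y = \<rho> *\<^sub>R unit_dir \<phi>" "0 < \<rho>" "\<rho> < r" "s < \<phi>" "\<phi> < t"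
        by (auto simp: S_def)
      then have "0 < \<rho> * sin (t - \<phi>)" "0 < \<rho> * sin (\<phi> - s)"
        using assms(7) by (auto intro!: mult_pos_pos sin_gt_zero)
      then show "0 < b \<bullet> y \<and> 0 < c \<bullet> y \<and> norm y < r"
        using cross [OF y(1)] y sin_pos assms(4,5) by (simp add: zero_less_mult_iff)
    next
      assume y: "0 < b \<bullet> y \<and> 0 < c \<bullet> y \<and> norm y < r"
      \<comment> \<open>With the window starting at \<open>s\<close>, a positive
        \<open>sin (\<phi> - s)\<close> places \<phi> less than a half turn after
        \<open>s\<close>.\<close>
      obtain \<phi> where \<phi>: "s \<le> \<phi>" "\<phi> < s + 2 * pi" "y = norm y *\<^sub>R unit_dir \<phi>"
        using polar_form [of s y] by blast
      have ny: "0 < norm y" using y by auto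
      have "0 < norm y * sin (t - \<phi>)" "0 < norm y * sin (\<phi> - s)"
        using cross [OF \<phi>(3)] y sin_pos assms(4,5) by simp_all
      then have pos: "0 < sin (t - \<phi>)" "0 < sin (\<phi> - s)"
        using ny by (simp_all add: zero_less_mult_iff)
      have "\<phi> - s < pi"
        using pos(2) sin_le_zero [of "\<phi> - s"] \<phi>(2) by force
      moreover have "\<phi> < t"
      proof (rule ccontr)
        assume "\<not> \<phi> < t"
        then have "0 \<le> sin (\<phi> - t)"
          using \<open>\<phi> - s < pi\<close> assms(6) by (intro sin_ge_zero) auto
        then show False using pos(1) sin_minus [of "t - \<phi>"] by simp
      qed
      moreover have "s < \<phi>"
        using pos(2) \<phi>(1) by (cases "s = \<phi>") auto
      ultimately show "y \<in> S"
        unfolding S_def using \<phi>(3) ny y by blast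
    qed
    let ?K = "{x. 0 \<le> b \<bullet> (x - A) \<and> 0 \<le> c \<bullet> (x - A)} \<inter> ball A r"
    have AS: "x \<in> (+) A ` S \<longleftrightarrow> x - A \<in> S" for x
      by (auto simp: image_iff intro!: bexI [of _ "x - A"])
    have "negligible ({x. b \<bullet> x = b \<bullet> A} \<union> {x. c \<bullet> x = c \<bullet> A})"
      using nz by (intro negligible_Un negligible_hyperplane) auto
    then have "negligible (((+) A ` S - ?K) \<union> (?K - (+) A ` S))"
      by (rule negligible_subset)
        (auto simp: AS S_iff dist_norm norm_minus_commute inner_diff_right inner_add_right)
    moreover have "(+) A ` S \<in> lmeasurable"
      using S by (simp add: measurable_translation)
    ultimately have "measure lebesgue ?K = measure lebesgue ((+) A ` S)"
      by (intro measure_negligible_symdiff)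
    with S show ?thesis by (simp add: measure_translation)
  qed
  then show ?thesis
    unfolding has_angle_at_def angle
    by (intro eventually_mono [OF eventually_at_right_less]) simp
qed

lemma angle_commute: "angle B A C = angle C A B"
  by (simp add: angle_def inner_commute mult.commute)

text \<open>Measured counterclockwise from \<open>B - A\<close>, the direction of
  \<open>C - A\<close> is reached either within a half turn or after more than one. The second case
  becomes the first when \<open>B\<close> and \<open>C\<close> are exchanged and a full turn is
  subtracted.\<close>

lemma has_angle_at_vertex:
  assumes "triangle A B C"
  shows "has_angle_at (closed_triangle A B C) A (angle B A C)"
proof -
  obtain b c where bc: "b \<bullet> (B - A) = 1" "b \<bullet> (C - A) = 0" "c \<bullet> (B - A) = 0" "c \<bullet> (C - A) = 1"
    "\<And>x. x = (b \<bullet> x) *\<^sub>R (B - A) + (c \<bullet> x) *\<^sub>R (C - A)"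
    using triangle_dual_basis [OF assms] by metis
  have nz: "b \<noteq> 0" "c \<noteq> 0" using bc by auto
  have pos: "0 < norm (B - A)" "0 < norm (C - A)"
    using triangle_distinct [OF assms] by auto
  obtain s where s: "B - A = norm (B - A) *\<^sub>R unit_dir s"
    using polar_form by metis
  obtain t where t: "s \<le> t" "t < s + 2 * pi" "C - A = norm (C - A) *\<^sub>R unit_dir t"
    using polar_form by metis
  \<comment> \<open>A vanishing sine is equality in the Cauchy-Schwarz inequality, hence
    collinearity.\<close>
  have "sin (t - s) \<noteq> 0"
  proof
    assume "sin (t - s) = 0"
    then have "(cos (t - s))\<^sup>2 = 1" by (simp add: cos_squared_eq)
    moreover have "(B - A) \<bullet> (C - A) = norm (B - A) * norm (C - A) * cos (t - s)"
      by (subst s, subst t(3)) (simp add: inner_unit_dir)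
    ultimately have "((B - A) \<bullet> (C - A))\<^sup>2 = ((B - A) \<bullet> (B - A)) * ((C - A) \<bullet> (C - A))"
      by (simp add: power_mult_distrib dot_square_norm)
    with assms show False by (simp add: triangle_iff_inner)
  qed
  then have "t \<noteq> s" "t \<noteq> s + pi" by auto
  with t(1,2) consider "s < t" "t < s + pi" | "t - 2 * pi < s" "s < t - 2 * pi + pi"
    by linarith
  then have "has_angle_at {x. 0 \<le> b \<bullet> (x - A) \<and> 0 \<le> c \<bullet> (x - A)} A (angle B A C)"
  proof cases
    case 1
    then show ?thesis
      using assms s t(3) pos bc(5) nz by (intro has_angle_at_cone_oriented)
  next
    case 2
    have "unit_dir (t - 2 * pi) = unit_dir t"
      by (simp add: vec2_eq_iff sin_diff cos_diff)
    then have "C - A = norm (C - A) *\<^sub>R unit_dir (t - 2 * pi)"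
      using t(3) by simp
    moreover have "y = (c \<bullet> y) *\<^sub>R (C - A) + (b \<bullet> y) *\<^sub>R (B - A)" for y
      using bc(5) [of y] by (simp add: add.commute)
    ultimately have "has_angle_at {x. 0 \<le> c \<bullet> (x - A) \<and> 0 \<le> b \<bullet> (x - A)} A (angle C A B)"
      using triangle_permute(2) [OF assms] s 2 pos nz by (intro has_angle_at_cone_oriented)
    then show ?thesis by (simp add: angle_commute conj_commute)
  qed
  \<comment> \<open>At \<open>A\<close> the third inequality is strict, so nearby the triangle is
    the cone of the other two.\<close>
  moreover have "open {x. b \<bullet> (x - A) + c \<bullet> (x - A) < 1}"
    by (intro open_Collect_less continuous_intros)
  ultimately show ?thesis
    by (elim has_angle_at_local [rotated 3]) (auto simp: closed_triangle_dual_basis [OF bc])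
qed

text \<open>The values \<open>j\<close> of 0, 1 and 2 belong to points outside, on an open side and
  inside. For a tile this makes the contribution an even number of right angles; for the large
  triangle the bound limits the angle to a full turn.\<close>

lemma has_angle_at_not_vertex:
  assumes "triangle A B C" "x \<notin> {A, B, C}"
  shows "\<exists>j :: nat. j \<le> 2 \<and> has_angle_at (closed_triangle A B C) x (of_nat j * pi)"
proof -
  obtain b c where bc: "b \<bullet> (B - A) = 1" "b \<bullet> (C - A) = 0" "c \<bullet> (B - A) = 0" "c \<bullet> (C - A) = 1"
    "\<And>x. x = (b \<bullet> x) *\<^sub>R (B - A) + (c \<bullet> x) *\<^sub>R (C - A)"
    using triangle_dual_basis [OF assms(1)] by metis
  note T = closed_triangle_dual_basis [OF bc]
  have nz: "b \<noteq> 0" "c \<noteq> 0" "- (b + c) \<noteq> 0"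
    using bc(1-4) inner_add_left [of b c "B - A"] by (auto simp: add_eq_0_iff)
  define f where "f y = b \<bullet> (y - A)" for y
  define g where "g y = c \<bullet> (y - A)" for y
  define h where "h y = 1 - f y - g y" for y
  have T: "closed_triangle A B C = {y. 0 \<le> f y \<and> 0 \<le> g y \<and> 0 \<le> h y}"
    unfolding T f_def g_def h_def by auto
  have [continuous_intros]: "continuous_on UNIV f" "continuous_on UNIV g" "continuous_on UNIV h"
    unfolding f_def [abs_def] g_def [abs_def] h_def [abs_def] by (intro continuous_intros)+
  have x: "x = A + f x *\<^sub>R (B - A) + g x *\<^sub>R (C - A)"
    using bc(5) [of "x - A"] unfolding f_def g_def by (simp add: algebra_simps)
  \<comment> \<open>Two vanishing barycentric coordinates single out a vertex.\<close>
  have vertex: "\<not> (f x = 0 \<and> g x = 0)" "\<not> (f x = 0 \<and> h x = 0)" "\<not> (g x = 0 \<and> h x = 0)"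
    using assms(2) x by (auto simp: h_def)
  \<comment> \<open>On an open side only one inequality is tight, and the triangle is locally a
    half-plane bounded by a line through \<open>x\<close>.\<close>
  have side: "has_angle_at (closed_triangle A B C) x pi"
    if "n \<noteq> 0" "open U" "x \<in> U" "\<And>y. y \<in> U \<Longrightarrow> y \<in> closed_triangle A B C \<longleftrightarrow> 0 \<le> n \<bullet> (y - x)" for n U
    using that by (intro has_angle_at_local [OF that(2,3) _ has_angle_at_halfplane [OF that(1)]]) auto
  consider "f x < 0" | "g x < 0" | "h x < 0" | "0 < f x" "0 < g x" "0 < h x"
    | "f x = 0" "0 < g x" "0 < h x" | "0 < f x" "g x = 0" "0 < h x" | "0 < f x" "0 < g x" "h x = 0"
    using vertex by argo
  then show ?thesis
  proof cases
    case 1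
    then have "has_angle_at (closed_triangle A B C) x 0"
      by (intro has_angle_at_local [where U = "{y. f y < 0}", OF _ _ _ has_angle_at_empty])
        (auto simp: T intro!: open_Collect_less continuous_intros)
    then show ?thesis by (intro exI [of _ 0]) simp
  next
    case 2
    then have "has_angle_at (closed_triangle A B C) x 0"
      by (intro has_angle_at_local [where U = "{y. g y < 0}", OF _ _ _ has_angle_at_empty])
        (auto simp: T intro!: open_Collect_less continuous_intros)
    then show ?thesis by (intro exI [of _ 0]) simp
  next
    case 3
    then have "has_angle_at (closed_triangle A B C) x 0"
      by (intro has_angle_at_local [where U = "{y. h y < 0}", OF _ _ _ has_angle_at_empty])
        (auto simp: T intro!: open_Collect_less continuous_intros)
    then show ?thesis by (intro exI [of _ 0]) simp
  next
    case 4
    then have "has_angle_at (closed_triangle A B C) x (2 * pi)"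
      by (intro has_angle_at_local [where U = "{y. 0 < f y \<and> 0 < g y \<and> 0 < h y}", OF _ _ _ has_angle_at_UNIV])
        (auto simp: T intro!: open_Collect_less open_Collect_conj continuous_intros)
    then show ?thesis by (intro exI [of _ 2]) simp
  next
    case 5
    then have "has_angle_at (closed_triangle A B C) x pi"
      by (intro side [OF nz(1), of "{y. 0 < g y \<and> 0 < h y}"])
        (auto simp: T f_def inner_diff_right intro!: open_Collect_less open_Collect_conj continuous_intros)
    then show ?thesis by (intro exI [of _ 1]) simp
  next
    case 6
    then have "has_angle_at (closed_triangle A B C) x pi"
      by (intro side [OF nz(2), of "{y. 0 < f y \<and> 0 < h y}"])
        (auto simp: T g_def inner_diff_right intro!: open_Collect_less open_Collect_conj continuous_intros)
    then show ?thesis by (intro exI [of _ 1]) simp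
  next
    case 7
    have "h y = - (b + c) \<bullet> (y - x)" for y
      using 7 by (simp add: h_def f_def g_def inner_diff_right inner_diff_left)
    then have "has_angle_at (closed_triangle A B C) x pi"
      using 7 by (intro side [OF nz(3), of "{y. 0 < f y \<and> 0 < g y}"])
        (auto simp: T intro!: open_Collect_less open_Collect_conj continuous_intros)
    then show ?thesis by (intro exI [of _ 1]) simp
  qed
qed

section \<open>Counting angles in tilings by right triangles\<close>

lemma right_triangle_angles:
  assumes "triangle P Q R" "angle P R Q = pi / 2"
  shows "angle Q P R + angle P Q R = pi / 2" "0 < angle Q P R" "0 < angle P Q R"
proof -
  define u v where "u = P - R" and "v = Q - R"
  define p q h where "p = norm u" and "q = norm v" and "h = norm (v - u)"
  have "P \<noteq> R" "Q \<noteq> R" "P \<noteq> Q"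
    using triangle_distinct [OF assms(1)] by auto
  then have pos: "0 < p" "0 < q" "0 < h"
    by (auto simp: p_def q_def h_def u_def v_def)
  have "\<bar>u \<bullet> v\<bar> \<le> p * q"
    \<comment> \<open>The bound matters because \<open>arccos\<close> can be inverted only for
      arguments between -1 and 1.\<close>
    unfolding p_def q_def by (rule Cauchy_Schwarz_ineq2)
  then have "\<bar>(u \<bullet> v) / (p * q)\<bar> \<le> 1"
    using pos by (simp add: abs_mult)
  moreover have "arccos ((u \<bullet> v) / (p * q)) = pi / 2"
    using assms(2) by (simp add: angle_def u_def v_def p_def q_def)
  ultimately have "(u \<bullet> v) / (p * q) = cos (pi / 2)"
    by (metis cos_arccos_abs)
  then have uv: "u \<bullet> v = 0"
    using pos by simp
  have h: "p\<^sup>2 + q\<^sup>2 = h\<^sup>2"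
    using uv unfolding p_def q_def h_def
    by (simp add: power2_norm_eq_inner inner_diff_left inner_diff_right inner_commute)
  have "p\<^sup>2 < h\<^sup>2" using h zero_less_power [OF pos(2), of 2] by linarith
  then have "p < h" using pos by (simp add: power2_less_imp_less)
  then have "p / h < 1" "0 < p / h"
    using pos by simp_all
  have "angle Q P R = arccos ((v - u) \<bullet> (- u) / (h * p))"
    by (simp add: angle_def u_def v_def h_def p_def norm_minus_commute)
  also have "(v - u) \<bullet> (- u) = p * p"
    using uv by (simp add: inner_diff_left inner_diff_right p_def norm_eq_sqrt_inner inner_commute)
  finally have a: "angle Q P R = arccos (p / h)"
    using pos by simp
  have "angle P Q R = arccos ((u - v) \<bullet> (- v) / (h * q))"
    by (simp add: angle_def u_def v_def h_def q_def norm_minus_commute)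
  also have "(u - v) \<bullet> (- v) = q * q"
    using uv by (simp add: inner_diff_left inner_diff_right q_def norm_eq_sqrt_inner inner_commute)
  finally have b: "angle P Q R = arccos (q / h)"
    using pos by simp
  define \<alpha> where "\<alpha> = arccos (p / h)"
  \<comment> \<open>By Pythagoras the cosine of the other acute angle is the sine of this one, so
    the two are complementary.\<close>
  have "sin \<alpha> = sqrt (1 - (p / h)\<^sup>2)"
    unfolding \<alpha>_def using \<open>p / h < 1\<close> \<open>0 < p / h\<close> by (intro sin_arccos) auto
  also have "1 - (p / h)\<^sup>2 = (q / h)\<^sup>2"
  proof -
    have "(p / h)\<^sup>2 + (q / h)\<^sup>2 = (p\<^sup>2 + q\<^sup>2) / h\<^sup>2"
      by (simp add: power_divide add_divide_distrib)
    then show ?thesis using h pos by simp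
  qed
  finally have "q / h = cos (pi / 2 - \<alpha>)"
    using pos by (simp add: cos_diff)
  moreover have "0 < \<alpha>" "\<alpha> < pi"
    unfolding \<alpha>_def using arccos_lt_bounded \<open>p / h < 1\<close> \<open>0 < p / h\<close> by auto
  moreover have "\<alpha> < pi / 2"
  proof (rule ccontr)
    assume "\<not> \<alpha> < pi / 2"
    then have "cos \<alpha> \<le> cos (pi / 2)"
      using \<open>\<alpha> < pi\<close> by (intro cos_monotone_0_pi_le) auto
    moreover have "cos \<alpha> = p / h"
      unfolding \<alpha>_def using \<open>p / h < 1\<close> \<open>0 < p / h\<close> by (intro cos_arccos) auto
    ultimately show False using \<open>0 < p / h\<close> by simp
  qed
  ultimately have "arccos (q / h) = pi / 2 - \<alpha>"
    by (simp only: arccos_cos)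
  with a b \<open>0 < \<alpha>\<close> \<open>\<alpha> < pi / 2\<close>
  show "angle Q P R + angle P Q R = pi / 2" "0 < angle Q P R" "0 < angle P Q R"
    by (simp_all add: \<alpha>_def)
qed

text \<open>The angles other than the right one are acute, so the right angle is the largest and the
  ordering gives \<open>\<alpha> \<le> pi / 2 - \<alpha>\<close>.\<close>

lemma right_tile_obtain:
  assumes "right_tile T \<alpha>"
  obtains P Q R where "triangle P Q R" "T = closed_triangle P Q R" "angle Q P R = \<alpha>"
    "angle P Q R = pi / 2 - \<alpha>" "angle P R Q = pi / 2" "0 < \<alpha>" "\<alpha> \<le> pi / 4"
proof -
  obtain \<beta> \<gamma> P Q R where t: "\<alpha> \<le> \<beta>" "\<beta> \<le> \<gamma>" "pi / 2 \<in> {\<alpha>, \<beta>, \<gamma>}" "triangle P Q R"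
    "T = closed_triangle P Q R" "angle Q P R = \<alpha>" "angle P Q R = \<beta>" "angle P R Q = \<gamma>"
    using assms unfolding right_tile_def tile_angles_def by blast
  have perm: "triangle P R Q" "triangle Q R P"
    using t(4) by (simp_all add: triangle_def insert_commute)
  have "\<alpha> \<noteq> pi / 2"
    using right_triangle_angles [of Q R P] perm t by (auto simp: angle_commute)
  moreover have "\<beta> \<noteq> pi / 2"
    using right_triangle_angles [of P R Q] perm t by (auto simp: angle_commute)
  ultimately have "\<gamma> = pi / 2" using t(3) by auto
  with right_triangle_angles [OF t(4)] t show ?thesis
    by (intro that [of P Q R]) auto
qed

lemma equilateral_inner:
  assumes "equilateral A B C"
  shows "(B - A) \<bullet> (B - A) = (dist A B)\<^sup>2" "(C - A) \<bullet> (C - A) = (dist A B)\<^sup>2"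
    "(B - A) \<bullet> (C - A) = (dist A B)\<^sup>2 / 2"
proof -
  have d: "norm (B - A) = dist A B" "norm (C - A) = dist A B" "norm ((B - A) - (C - A)) = dist A B"
    using assms by (simp_all add: equilateral_def dist_norm norm_minus_commute)
  then show "(B - A) \<bullet> (B - A) = (dist A B)\<^sup>2" "(C - A) \<bullet> (C - A) = (dist A B)\<^sup>2"
    by (simp_all add: dot_square_norm)
  then show "(B - A) \<bullet> (C - A) = (dist A B)\<^sup>2 / 2"
    using d(3) dot_norm_neg [of "B - A" "C - A"] by (simp add: dot_square_norm)
qed

lemma equilateral_rotate:
  assumes "equilateral A B C" shows "equilateral B C A"
  using assms triangle_permute(1) [of A B C] by (auto simp: equilateral_def)

lemma equilateral_angle:
  assumes "equilateral A B C" shows "angle B A C = pi / 3"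
proof -
  have "A \<noteq> B" using assms triangle_distinct by (auto simp: equilateral_def)
  then have "(B - A) \<bullet> (C - A) / (norm (B - A) * norm (C - A)) = cos (pi / 3)"
    unfolding norm_eq_sqrt_inner equilateral_inner [OF assms]
    by (simp add: cos_60 power2_eq_square)
  then show ?thesis
    by (simp add: angle_def arccos_cos)
qed

text \<open>Right-angled vertices, sides and interior points all contribute multiples of a right
  angle, collected in \<open>j\<close>. Only the two acute vertices have to be tracked
  separately.\<close>

lemma angle_at_tile:
  assumes "triangle P Q R" "angle Q P R = \<alpha>" "angle P Q R = \<beta>" "angle P R Q = pi / 2"
  shows "\<exists>j :: nat. has_angle_at (closed_triangle P Q R) x
           ((if P = x then \<alpha> else 0) + (if Q = x then \<beta> else 0) + of_nat j * (pi / 2))"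
proof -
  note ne = triangle_distinct [OF assms(1)]
  have v: "has_angle_at (closed_triangle P Q R) P \<alpha>"
      "has_angle_at (closed_triangle P Q R) Q \<beta>"
      "has_angle_at (closed_triangle P Q R) R (pi / 2)"
    using has_angle_at_vertex [of P Q R] has_angle_at_vertex [of Q P R] has_angle_at_vertex [of R P Q] assms
    by (simp_all add: triangle_def closed_triangle_def insert_commute)
  consider "x = P" | "x = Q" | "x = R" | "x \<notin> {P, Q, R}" by blast
  then show ?thesis
  proof cases
    case 1
    with ne v(1) show ?thesis by (intro exI [of _ 0]) auto
  next
    case 2
    with ne v(2) show ?thesis by (intro exI [of _ 0]) auto
  next
    case 3
    with ne v(3) show ?thesis by (intro exI [of _ 1]) auto
  next
    case 4
    obtain j :: nat where "has_angle_at (closed_triangle P Q R) x (of_nat j * pi)"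
      using has_angle_at_not_vertex [OF assms(1) 4] by blast
    with 4 show ?thesis by (intro exI [of _ "2 * j"]) auto
  qed
qed

section \<open>Nonexistence of tilings by the other right triangles\<close>

lemma no_right_tiling_equilateral:
  assumes eq: "equilateral A B C" and T: "right_tile T \<alpha>" "\<alpha> \<noteq> pi / 6"
  shows "\<not> can_be_tiled n A B C T"
proof
  assume "can_be_tiled n A B C T"
  then obtain \<T> where "is_tiling \<T> n A B C T"
    unfolding can_be_tiled_def ..
  then have \<T>: "finite \<T>" "\<And>S. S \<in> \<T> \<Longrightarrow> congruent_sets S T"
    "\<And>S S'. S \<in> \<T> \<Longrightarrow> S' \<in> \<T> \<Longrightarrow> S \<noteq> S' \<Longrightarrow> interior S \<inter> interior S' = {}"
    "\<Union>\<T> = closed_triangle A B C"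
    by (simp_all add: is_tiling_def)
  obtain P Q R where PQR: "triangle P Q R" "T = closed_triangle P Q R" "angle Q P R = \<alpha>"
    "angle P Q R = pi / 2 - \<alpha>" "angle P R Q = pi / 2" and \<alpha>: "0 < \<alpha>" "\<alpha> \<le> pi / 4"
    using T(1) by (rule right_tile_obtain)
  define \<beta> where "\<beta> = pi / 2 - \<alpha>"
  have "\<forall>S\<in>\<T>. \<exists>P Q R. triangle P Q R \<and> S = closed_triangle P Q R \<and> angle Q P R = \<alpha> \<and>
      angle P Q R = \<beta> \<and> angle P R Q = pi / 2"
  proof
    fix S assume "S \<in> \<T>"
    then have "congruent_sets S (closed_triangle P Q R)" using \<T>(2) PQR(2) by simp
    then show "\<exists>P Q R. triangle P Q R \<and> S = closed_triangle P Q R \<and> angle Q P R = \<alpha> \<and>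
      angle P Q R = \<beta> \<and> angle P R Q = pi / 2"
      by (rule congruent_closed_triangle [OF _ PQR(1)]) (use PQR in \<open>auto simp: \<beta>_def\<close>)
  qed
  then obtain p q r where tile: "\<And>S. S \<in> \<T> \<Longrightarrow> triangle (p S) (q S) (r S) \<and>
      S = closed_triangle (p S) (q S) (r S) \<and> angle (q S) (p S) (r S) = \<alpha> \<and>
      angle (p S) (q S) (r S) = \<beta> \<and> angle (p S) (r S) (q S) = pi / 2"
    by metis
  \<comment> \<open>Every tile has one acute vertex of each kind, so \<open>a\<close> and
    \<open>b\<close> have the same total over all points.\<close>
  define a where "a x = card {S \<in> \<T>. p S = x}" for x
  define b where "b x = card {S \<in> \<T>. q S = x}" for x
  have sum_eq: "\<exists>J :: nat. of_nat (a x) * \<alpha> + of_nat (b x) * \<beta> + of_nat J * (pi / 2) = W"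
    if W: "has_angle_at (closed_triangle A B C) x W" for x W
  proof -
    have "\<exists>j :: nat. has_angle_at S x
        ((if p S = x then \<alpha> else 0) + (if q S = x then \<beta> else 0) + of_nat j * (pi / 2))" if "S \<in> \<T>" for S
      using angle_at_tile [of "p S" "q S" "r S" \<alpha> \<beta> x] tile [OF that] by metis
    then obtain j :: "point set \<Rightarrow> nat" where j: "\<And>S. S \<in> \<T> \<Longrightarrow> has_angle_at S x
        ((if p S = x then \<alpha> else 0) + (if q S = x then \<beta> else 0) + of_nat (j S) * (pi / 2))"
      by metis
    have "convex S" if "S \<in> \<T>" for S
      using tile [OF that] by (metis closed_triangle_def convex_convex_hull)
    then have "has_angle_at (\<Union>\<T>) x (\<Sum>S\<in>\<T>.
        (if p S = x then \<alpha> else 0) + (if q S = x then \<beta> else 0) + of_nat (j S) * (pi / 2))"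
      using \<T> j by (intro has_angle_at_Union)
    then have sum: "(\<Sum>S\<in>\<T>. (if p S = x then \<alpha> else 0) + (if q S = x then \<beta> else 0) + of_nat (j S) * (pi / 2)) = W"
      unfolding \<T>(4) by (rule has_angle_at_unique [OF _ W])
    have "(\<Sum>S\<in>\<T>. if p S = x then \<alpha> else 0) = of_nat (a x) * \<alpha>"
      "(\<Sum>S\<in>\<T>. if q S = x then \<beta> else 0) = of_nat (b x) * \<beta>"
      unfolding a_def b_def using \<T>(1) by (simp_all flip: sum.inter_filter)
    moreover have "(\<Sum>S\<in>\<T>. of_nat (j S) * (pi / 2)) = of_nat (\<Sum>S\<in>\<T>. j S) * (pi / 2)"
      by (simp only: of_nat_sum sum_distrib_right)
    ultimately have "of_nat (a x) * \<alpha> + of_nat (b x) * \<beta> + of_nat (\<Sum>S\<in>\<T>. j S) * (pi / 2) = W"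
      unfolding sum [symmetric] sum.distrib by presburger
    then show ?thesis by blast
  qed
  have corner: "\<exists>J :: nat. of_nat (a x) * \<alpha> + of_nat (b x) * \<beta> + of_nat J * (pi / 2) = pi / 3"
    if "x \<in> {A, B, C}" for x
  proof -
    have "has_angle_at (closed_triangle A B C) x (pi / 3)"
      using that has_angle_at_vertex equilateral_angle eq equilateral_rotate closed_triangle_permute(1)
      unfolding equilateral_def by (metis insertE singletonD)
    then show ?thesis by (rule sum_eq)
  qed
  obtain J :: nat where J: "of_nat (a A) * \<alpha> + of_nat (b A) * \<beta> + of_nat J * (pi / 2) = pi / 3"
    using corner by blast
  have nonneg: "0 \<le> of_nat (a x) * \<alpha>" "0 \<le> of_nat (b x) * \<beta>" for x
    using \<alpha> by (simp_all add: \<beta>_def)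
  show False
  proof (cases "\<alpha> < pi / 6")
    case False
    then have gt: "pi / 6 < \<alpha>" "pi / 6 < \<beta>" "\<alpha> < pi / 3" "\<beta> < pi / 3"
      using T(2) \<alpha> by (auto simp: \<beta>_def)
    have "J = 0"
    proof (rule ccontr)
      assume "J \<noteq> 0"
      then have "1 * (pi / 2) \<le> of_nat J * (pi / 2)"
        by (intro mult_right_mono) auto
      with J nonneg [of A] pi_gt_zero show False by linarith
    qed
    have le: "of_nat (a A) * (pi / 6) \<le> of_nat (a A) * \<alpha>" "of_nat (b A) * (pi / 6) \<le> of_nat (b A) * \<beta>"
      by (intro mult_left_mono less_imp_le gt of_nat_0_le_iff)+
    then have "of_nat (a A + b A) * (pi / 6) \<le> 2 * (pi / 6)"
      using J \<open>J = 0\<close> by (simp add: algebra_simps)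
    then have "real (a A + b A) \<le> 2"
      by (rule mult_right_le_imp_le) simp
    then have "a A + b A \<le> 2" by linarith
    \<comment> \<open>Both acute angles lie strictly between \<open>pi / 6\<close> and
      \<open>pi / 3\<close>: one is too small for the corner and two are too large.\<close>
    then consider "a A = 0" "b A = 0" | "a A = 1" "b A = 0" | "a A = 0" "b A = 1"
      | "a A = 2" "b A = 0" | "a A = 1" "b A = 1" | "a A = 0" "b A = 2"
      by linarith
    then show False
      using J \<open>J = 0\<close> gt by cases auto
  next
    case True
    then have \<beta>: "pi / 3 < \<beta>" "\<beta> < pi / 2"
      using \<alpha> by (auto simp: \<beta>_def)
    \<comment> \<open>Both \<beta> and a right angle exceed the corner angle, so neither occurs
      there.\<close>
    have corner0: "b x = 0 \<and> of_nat (a x) * \<alpha> = pi / 3" if "x \<in> {A, B, C}" for x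
    proof -
      obtain J :: nat where J: "of_nat (a x) * \<alpha> + of_nat (b x) * \<beta> + of_nat J * (pi / 2) = pi / 3"
        using corner [OF \<open>x \<in> {A, B, C}\<close>] by blast
      have "J = 0"
      proof (rule ccontr)
        assume "J \<noteq> 0"
        then have "1 * (pi / 2) \<le> of_nat J * (pi / 2)"
          by (intro mult_right_mono) auto
        with J nonneg [of x] pi_gt_zero show False by linarith
      qed
      moreover have "b x = 0"
      proof (rule ccontr)
        assume "b x \<noteq> 0"
        then have "1 * \<beta> \<le> of_nat (b x) * \<beta>"
          using \<beta> pi_gt_zero by (intro mult_right_mono) auto
        with J nonneg [of x] \<beta> \<open>J = 0\<close> show False by simp
      qed
      ultimately show ?thesis using J by simp
    qed
    \<comment> \<open>\<open>X\<close> contains the acute vertices of all tiles, so both sums over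
      it count every tile once. It also contains the corner \<open>A\<close>, where \<open>a\<close>
      is strictly larger than \<open>b\<close>.\<close>
    define X where "X = {A, B, C} \<union> p ` \<T> \<union> q ` \<T>"
    have "finite X" using \<T>(1) by (simp add: X_def)
    have "sum a X = card \<T>"
      unfolding a_def card_eq_sum using \<T>(1) \<open>finite X\<close> by (intro sum.group) (auto simp: X_def)
    moreover have "sum b X = card \<T>"
      unfolding b_def card_eq_sum using \<T>(1) \<open>finite X\<close> by (intro sum.group) (auto simp: X_def)
    moreover have "sum b X < sum a X" if "\<forall>x\<in>X. b x \<le> a x"
    proof (rule sum_strict_mono_ex1 [OF \<open>finite X\<close> that])
      have "a A \<noteq> 0"
      proof
        assume "a A = 0"
        with corner0 [of A] show False by simp
      qed
      then show "\<exists>x\<in>X. b x < a x"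
        using corner0 [of A] by (intro bexI [of _ A]) (auto simp: X_def)
    qed
    ultimately have "\<not> (\<forall>x\<in>X. b x \<le> a x)"
      by auto
    then obtain x where x: "a x < b x"
      by (auto simp: not_le)
    then have "x \<notin> {A, B, C}" using corner0 by fastforce
    then obtain k :: nat where k: "k \<le> 2" "has_angle_at (closed_triangle A B C) x (of_nat k * pi)"
      using has_angle_at_not_vertex eq unfolding equilateral_def by blast
    obtain J :: nat where J: "of_nat (a x) * \<alpha> + of_nat (b x) * \<beta> + of_nat J * (pi / 2) = of_nat k * pi"
      using sum_eq [OF k(2)] by blast
    \<comment> \<open>Substituting \<open>\<alpha> = pi / 2 - \<beta>\<close> into the angle sum
      leaves a multiple of \<beta> equal to a multiple of a right angle.\<close>
    define s where "s = int (b x) - int (a x)"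
    define i where "i = 2 * int k - int (a x) - int J"
    have s: "of_int s * \<beta> = of_int i * (pi / 2)"
      using J by (simp add: s_def i_def \<beta>_def algebra_simps)
    have "1 \<le> s" using x by (simp add: s_def)
    then have "of_int s * (pi / 3) < of_int s * \<beta>" "of_int s * \<beta> < of_int s * (pi / 2)"
      using \<beta> by (auto intro!: mult_strict_left_mono)
    then have "of_int (2 * s) * (pi / 6) < of_int (3 * i) * (pi / 6)" "of_int i * (pi / 2) < of_int s * (pi / 2)"
      unfolding s by simp_all
    then have "real_of_int (2 * s) < of_int (3 * i)" "real_of_int i < of_int s"
      by (simp_all only: mult_less_cancel_right_pos pi_gt_zero divide_pos_pos zero_less_numeral)
    then have "2 * s < 3 * i" "i < s" by linarith+
    moreover have "i \<le> 4" using k(1) by (simp add: i_def)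
    \<comment> \<open>From \<open>i < s\<close> and \<open>2 * s < 3 * i\<close>, the values 1 and 2
      of \<open>i\<close> leave no integer \<open>s\<close>, while 3 and 4 leave one each.\<close>
    ultimately consider "i = 3" "s = 4" | "i = 4" "s = 5"
      using \<open>1 \<le> s\<close> by linarith
    then have "\<alpha> = pi / 8 \<or> \<alpha> = pi / 10"
      using s by cases (auto simp: \<beta>_def)
    moreover have "of_nat (a A) * \<alpha> = pi / 3"
      using corner0 by blast
    \<comment> \<open>At the corner \<open>A\<close> these two values would need
      \<open>8 / 3\<close> or \<open>10 / 3\<close> copies of \<alpha>.\<close>
    ultimately have "real (3 * a A) * pi = 8 * pi \<or> real (3 * a A) * pi = 10 * pi"
      by (elim disjE) simp_all
    then have "real (3 * a A) = 8 \<or> real (3 * a A) = 10"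
      by (simp only: mult_cancel_right pi_neq_zero) simp
    then have "3 * a A = 8 \<or> 3 * a A = 10" by linarith
    then show False by presburger
  qed
qed

section \<open>Refining tilings\<close>

lemma congruent_interior_empty_iff:
  assumes "congruent_sets S T" shows "interior S = {} \<longleftrightarrow> interior T = {}"
proof -
  obtain f where f: "\<And>x y. dist (f x) (f y) = dist x y" "T = f ` S"
    using assms by (auto simp: congruent_sets_def)
  then show ?thesis by (simp add: isometry_properties(3) [OF f(1)])
qed

text \<open>A tiling is a set, so its cardinality is the size of the index set only if no tile
  repeats. A repeated tile would have an interior disjoint from itself, although tiles have nonempty
  interior.\<close>

lemma can_be_tiled_indexed:
  assumes "finite I" "\<And>i. i \<in> I \<Longrightarrow> congruent_sets (F i) T" "interior T \<noteq> {}"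
    and disj: "\<And>i j. i \<in> I \<Longrightarrow> j \<in> I \<Longrightarrow> i \<noteq> j \<Longrightarrow> interior (F i) \<inter> interior (F j) = {}"
    and "(\<Union>i\<in>I. F i) = closed_triangle A B C" "N = card I"
  shows "can_be_tiled N A B C T"
proof -
  have "inj_on F I"
  proof (rule inj_onI, rule ccontr)
    fix i j assume ij: "i \<in> I" "j \<in> I" "F i = F j" "i \<noteq> j"
    then have "interior (F i) = {}" using disj [of i j] by simp
    then show False using congruent_interior_empty_iff assms(2,3) ij by metis
  qed
  then have "is_tiling (F ` I) N A B C T"
    unfolding is_tiling_def using assms by (auto simp: card_image)
  then show ?thesis by (auto simp: can_be_tiled_def)
qed

text \<open>Each coarse tile is the image of the triangle \<open>P Q R\<close> under an isometry,
  which carries the fine tiling into it. The new tiles are indexed by pairs of a coarse and a fine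
  tile.\<close>

lemma can_be_tiled_refine:
  assumes "can_be_tiled N A B C (closed_triangle P Q R)" "can_be_tiled M P Q R T" "interior T \<noteq> {}"
  shows "can_be_tiled (N * M) A B C T"
proof -
  obtain \<T> \<U> where \<T>: "is_tiling \<T> N A B C (closed_triangle P Q R)" and \<U>: "is_tiling \<U> M P Q R T"
    using assms(1,2) unfolding can_be_tiled_def by blast
  have "\<forall>S\<in>\<T>. \<exists>f. (\<forall>x y. dist (f x) (f y) = dist x y) \<and> f ` closed_triangle P Q R = S"
  proof
    fix S assume "S \<in> \<T>"
    then have "congruent_sets (closed_triangle P Q R) S"
      using \<T> by (simp add: is_tiling_def congruent_sets_sym)
    then show "\<exists>f. (\<forall>x y. dist (f x) (f y) = dist x y) \<and> f ` closed_triangle P Q R = S"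
      by (simp add: congruent_sets_def)
  qed
  then obtain g where "\<forall>S\<in>\<T>. (\<forall>x y. dist (g S x) (g S y) = dist x y) \<and> g S ` closed_triangle P Q R = S"
    by (rule bchoice [THEN exE])
  then have iso: "\<And>S x y. S \<in> \<T> \<Longrightarrow> dist (g S x) (g S y) = dist x y"
    and img: "\<And>S. S \<in> \<T> \<Longrightarrow> g S ` closed_triangle P Q R = S"
    by blast+
  have sub: "g S ` U \<subseteq> S" if "S \<in> \<T>" "U \<in> \<U>" for S U
    using img [OF that(1)] that(2) \<U> unfolding is_tiling_def by blast
  show ?thesis
  proof (rule can_be_tiled_indexed)
    show "finite (\<T> \<times> \<U>)" "N * M = card (\<T> \<times> \<U>)"
      using \<T> \<U> by (simp_all add: is_tiling_def card_cartesian_product)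
    show "congruent_sets (case i of (S, U) \<Rightarrow> g S ` U) T" if "i \<in> \<T> \<times> \<U>" for i
    proof -
      obtain S U where i: "i = (S, U)" "S \<in> \<T>" "U \<in> \<U>"
        using \<open>i \<in> \<T> \<times> \<U>\<close> by auto
      have c: "congruent_sets U (g S ` U)"
        using iso [OF i(2)] unfolding congruent_sets_def by blast
      have "congruent_sets U T" using \<U> i(3) by (simp add: is_tiling_def)
      then have "congruent_sets (g S ` U) T"
        by (rule congruent_sets_trans [OF congruent_sets_sym [OF c]])
      then show ?thesis using i(1) by simp
    qed
    show "interior (case i of (S, U) \<Rightarrow> g S ` U) \<inter> interior (case j of (S, U) \<Rightarrow> g S ` U) = {}"
      if "i \<in> \<T> \<times> \<U>" "j \<in> \<T> \<times> \<U>" "i \<noteq> j" for i j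
    proof -
      obtain S U S' U' where ij: "i = (S, U)" "j = (S', U')" "S \<in> \<T>" "U \<in> \<U>" "S' \<in> \<T>" "U' \<in> \<U>"
        using \<open>i \<in> \<T> \<times> \<U>\<close> \<open>j \<in> \<T> \<times> \<U>\<close> by auto
      show ?thesis
      \<comment> \<open>Within one coarse tile disjointness comes from the fine tiling and
        injectivity; across two coarse tiles it comes from the coarse tiling.\<close>
      proof (cases "S = S'")
        case True
        then have "interior U \<inter> interior U' = {}"
          using \<U> ij that(3) by (simp add: is_tiling_def)
        moreover have "inj (g S)"
          using isometry_properties(1) iso [OF ij(3)] bij_is_inj by blast
        ultimately have "g S ` interior U \<inter> g S ` interior U' = {}"
          using image_Int [of "g S" "interior U" "interior U'"] by simp
        then show ?thesis
          using True ij isometry_properties(3) [OF iso [OF ij(3)]] by simp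
      next
        case False
        then have "interior S \<inter> interior S' = {}"
          using \<T> ij by (simp add: is_tiling_def)
        moreover have "interior (g S ` U) \<subseteq> interior S" "interior (g S' ` U') \<subseteq> interior S'"
          using sub ij by (simp_all add: interior_mono)
        ultimately show ?thesis using ij by auto
      qed
    qed
    have "(\<Union>U\<in>\<U>. g S ` U) = S" if "S \<in> \<T>" for S
    proof -
      have "(\<Union>U\<in>\<U>. g S ` U) = g S ` \<Union>\<U>" by blast
      then show ?thesis using \<U> img [OF that] by (simp add: is_tiling_def)
    qed
    then have "(\<Union>S\<in>\<T>. \<Union>U\<in>\<U>. g S ` U) = \<Union>\<T>" by simp
    moreover have "(\<Union>i\<in>\<T> \<times> \<U>. case i of (S, U) \<Rightarrow> g S ` U) = (\<Union>S\<in>\<T>. \<Union>U\<in>\<U>. g S ` U)"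
      by auto
    ultimately show "(\<Union>i\<in>\<T> \<times> \<U>. case i of (S, U) \<Rightarrow> g S ` U) = closed_triangle A B C"
      using \<T> by (simp add: is_tiling_def)
  qed (fact assms(3))
qed

text \<open>By polarisation the side lengths determine the inner products of the edges, so the
  affine map matching the vertices preserves distances.\<close>

lemma congruent_SSS:
  assumes "triangle P Q R" "dist P' Q' = dist P Q" "dist P' R' = dist P R" "dist Q' R' = dist Q R"
  shows "congruent_sets (closed_triangle P Q R) (closed_triangle P' Q' R')"
proof -
  obtain b c where bc: "b \<bullet> (Q - P) = 1" "b \<bullet> (R - P) = 0" "c \<bullet> (Q - P) = 0" "c \<bullet> (R - P) = 1"
    "\<And>x. x = (b \<bullet> x) *\<^sub>R (Q - P) + (c \<bullet> x) *\<^sub>R (R - P)"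
    using triangle_dual_basis [OF assms(1)] by metis
  define u v u' v' where "u = Q - P" and "v = R - P" and "u' = Q' - P'" and "v' = R' - P'"
  have n: "norm u' = norm u" "norm v' = norm v" "norm (u' - v') = norm (u - v)"
    using assms(2-4) by (simp_all add: u_def v_def u'_def v'_def dist_norm norm_minus_commute)
  then have inn: "u' \<bullet> u' = u \<bullet> u" "v' \<bullet> v' = v \<bullet> v" "u' \<bullet> v' = u \<bullet> v"
    by (simp_all add: dot_square_norm dot_norm_neg)
  have norm: "norm (s *\<^sub>R u' + t *\<^sub>R v') = norm (s *\<^sub>R u + t *\<^sub>R v)" for s t
    using inn by (simp add: norm_eq_sqrt_inner inner_add_left inner_add_right inner_commute)
  define f where "f x = P' + (b \<bullet> (x - P)) *\<^sub>R u' + (c \<bullet> (x - P)) *\<^sub>R v'" for x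
  have iso: "dist (f x) (f y) = dist x y" for x y
  proof -
    have "f x - f y = (b \<bullet> (x - y)) *\<^sub>R u' + (c \<bullet> (x - y)) *\<^sub>R v'"
      by (simp add: f_def inner_diff_right algebra_simps)
    then have "norm (f x - f y) = norm ((b \<bullet> (x - y)) *\<^sub>R u + (c \<bullet> (x - y)) *\<^sub>R v)"
      by (simp only: norm)
    then show ?thesis
      unfolding dist_norm u_def v_def bc(5) [of "x - y", symmetric] .
  qed
  have "f P = P'" "f Q = Q'" "f R = R'"
    using bc(1-4) by (simp_all add: f_def u'_def v'_def)
  then have "f ` closed_triangle P Q R = closed_triangle P' Q' R'"
    using isometry_closed_triangle [OF iso] by simp
  with iso show ?thesis unfolding congruent_sets_def by blast
qed

lemma closed_triangle_subset:
  assumes "convex K" "P \<in> K" "Q \<in> K" "R \<in> K" shows "closed_triangle P Q R \<subseteq> K"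
  unfolding closed_triangle_def using assms by (simp add: hull_minimal)

lemma closed_triangles_separated:
  assumes "n \<noteq> 0" "n \<bullet> P \<le> k" "n \<bullet> Q \<le> k" "n \<bullet> R \<le> k" "k \<le> n \<bullet> P'" "k \<le> n \<bullet> Q'" "k \<le> n \<bullet> R'"
  shows "interior (closed_triangle P Q R) \<inter> interior (closed_triangle P' Q' R') = {}"
  using assms convex_halfspace_le [of n k] convex_halfspace_ge [of k n]
  by (intro interiors_separated [of n _ k] closed_triangle_subset) auto

lemma isosceles_halving:
  assumes "triangle P Q R" "dist P Q = dist P R"
  defines "M \<equiv> midpoint Q R"
  shows "can_be_tiled 2 P Q R (closed_triangle P Q M)" "triangle P Q M"
    "angle P M Q = pi / 2" "angle P Q M = angle P Q R"
proof -
  obtain b c where bc: "b \<bullet> (Q - P) = 1" "b \<bullet> (R - P) = 0" "c \<bullet> (Q - P) = 0" "c \<bullet> (R - P) = 1"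
    "\<And>x. x = (b \<bullet> x) *\<^sub>R (Q - P) + (c \<bullet> x) *\<^sub>R (R - P)"
    using triangle_dual_basis [OF assms(1)] by metis
  have bc': "b \<bullet> Q = 1 + b \<bullet> P" "b \<bullet> R = b \<bullet> P" "c \<bullet> Q = c \<bullet> P" "c \<bullet> R = 1 + c \<bullet> P"
    using bc(1-4) by (simp_all add: inner_diff_right)
  have M: "M = (1 / 2) *\<^sub>R Q + (1 / 2) *\<^sub>R R"
    by (simp add: M_def midpoint_def scaleR_add_right)
  have MQ: "M - Q = (1 / 2) *\<^sub>R (R - Q)"
    by (simp add: M vec2_eq_iff field_simps)
  have inn: "(M - Q) \<bullet> (M - Q) = (1 / 4) * ((R - Q) \<bullet> (R - Q))"
      "(M - Q) \<bullet> (P - Q) = (1 / 2) * ((P - Q) \<bullet> (R - Q))"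
    by (simp_all add: MQ inner_commute)
  have "triangle Q P R" using assms(1) by (simp add: triangle_def insert_commute)
  then have "triangle Q M P"
    unfolding triangle_iff_inner inn by (simp add: power_mult_distrib power_divide mult.commute)
  then show tri: "triangle P Q M" by (simp add: triangle_def insert_commute)
  have "norm (M - Q) = (1 / 2) * norm (R - Q)" by (simp add: MQ)
  then show "angle P Q M = angle P Q R"
    by (simp add: angle_def MQ)
  have "(P - Q) \<bullet> (P - Q) = (P - R) \<bullet> (P - R)"
    using assms(2) by (simp add: dot_square_norm dist_norm)
  then have "(P - M) \<bullet> (Q - M) = 0"
    by (simp add: M inner_vec2 algebra_simps)
  then show "angle P M Q = pi / 2" by (simp add: angle_def)
  have congR: "congruent_sets (closed_triangle P R M) (closed_triangle P Q M)"
    using assms(2) by (intro congruent_sets_sym [OF congruent_SSS [OF tri]]) (simp_all add: M_def dist_midpoint)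
  show "can_be_tiled 2 P Q R (closed_triangle P Q M)"
  proof (rule can_be_tiled_indexed)
    show "finite {Q, R}" "interior (closed_triangle P Q M) \<noteq> {}" "2 = card {Q, R}"
      using interior_closed_triangle_nonempty [OF tri] triangle_distinct [OF assms(1)] by simp_all
    show "congruent_sets (closed_triangle P i M) (closed_triangle P Q M)" if "i \<in> {Q, R}" for i
      using that congR congruent_SSS [OF tri] by auto
    \<comment> \<open>The functional \<open>c - b\<close> is constant on the median through
      \<open>P\<close> and \<open>M\<close>, which separates the halves.\<close>
    have "c - b \<noteq> 0" using bc by auto
    then have "interior (closed_triangle P Q M) \<inter> interior (closed_triangle P R M) = {}"
      by (rule closed_triangles_separated [where k = "(c - b) \<bullet> P"])
        (simp_all add: M bc' inner_diff_left inner_add_right field_simps)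
    then show "interior (closed_triangle P i M) \<inter> interior (closed_triangle P j M) = {}"
      if "i \<in> {Q, R}" "j \<in> {Q, R}" "i \<noteq> j" for i j
      using that by (auto simp: Int_commute)
    have sub: "closed_triangle P Q M \<subseteq> closed_triangle P Q R" "closed_triangle P R M \<subseteq> closed_triangle P Q R"
    proof -
      have "M \<in> convex hull {Q, R}"
        unfolding M_def by (metis midpoint_in_closed_segment segment_convex_hull)
      then have "M \<in> closed_triangle P Q R"
        unfolding closed_triangle_def using hull_mono [of "{Q, R}" "{P, Q, R}" convex] by blast
      then show "closed_triangle P Q M \<subseteq> closed_triangle P Q R" "closed_triangle P R M \<subseteq> closed_triangle P Q R"
        unfolding closed_triangle_def [of P Q M] closed_triangle_def [of P R M]
        by (intro hull_minimal; auto simp: closed_triangle_def hull_inc)+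
    qed
    have "x \<in> closed_triangle P Q M \<union> closed_triangle P R M" if x: "x \<in> closed_triangle P Q R" for x
    proof -
      obtain k s t where k: "x = k *\<^sub>R P + s *\<^sub>R Q + t *\<^sub>R R" "0 \<le> k" "0 \<le> s" "0 \<le> t" "k + s + t = 1"
        using x unfolding closed_triangle_def convex_hull_3 by blast
      \<comment> \<open>Equal shares of \<open>Q\<close> and \<open>R\<close> merge into
        \<open>M\<close>; the larger of the two weights decides which half contains
        \<open>x\<close>.\<close>
      have "x = k *\<^sub>R P + (s - t) *\<^sub>R Q + (2 * t) *\<^sub>R M" "x = k *\<^sub>R P + (t - s) *\<^sub>R R + (2 * s) *\<^sub>R M"
        unfolding M k(1) by (simp_all add: vec2_eq_iff algebra_simps)
      moreover have "k + (s - t) + 2 * t = 1" "k + (t - s) + 2 * s = 1" using k by simp_all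
      moreover have "0 \<le> s - t \<or> 0 \<le> t - s" "0 \<le> 2 * t" "0 \<le> 2 * s" using k by auto
      ultimately show ?thesis
        unfolding closed_triangle_def convex_hull_3 using k(2) by blast
    qed
    with sub show "(\<Union>i\<in>{Q, R}. closed_triangle P i M) = closed_triangle P Q R"
      by auto
  qed
qed

section \<open>Subdivisions of the equilateral triangle\<close>

lemma centroid_equilateral:
  fixes A B C :: point
  assumes "equilateral A B C"
  defines "G \<equiv> (1 / 3) *\<^sub>R (A + B + C)"
  shows "triangle G A B" "(dist G A)\<^sup>2 = (dist A B)\<^sup>2 / 3" "angle G A B = pi / 6"
proof -
  define u v where "u = B - A" and "v = C - A"
  define s where "s = dist A B"
  note i = equilateral_inner [OF assms(1), folded u_def v_def s_def]
  have "A \<noteq> B" using assms triangle_distinct by (auto simp: equilateral_def)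
  then have s: "0 < s" by (simp add: s_def)
  have G: "G - A = (1 / 3) *\<^sub>R (u + v)"
    by (simp add: G_def u_def v_def vec2_eq_iff)
  have GG: "(G - A) \<bullet> (G - A) = s\<^sup>2 / 3" and GB: "(G - A) \<bullet> (B - A) = s\<^sup>2 / 2" and BB: "(B - A) \<bullet> (B - A) = s\<^sup>2"
    using i unfolding G u_def [symmetric] by (simp_all add: inner_add_left inner_add_right inner_commute)
  have "triangle A G B"
    unfolding triangle_iff_inner GG GB BB using s by (simp add: power2_eq_square)
  then show "triangle G A B" by (simp add: triangle_def insert_commute)
  show "(dist G A)\<^sup>2 = (dist A B)\<^sup>2 / 3"
    using GG by (simp add: dist_norm dot_square_norm s_def)
  have n: "norm (G - A) = s / sqrt 3" "norm (B - A) = s"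
    using s by (simp_all add: norm_eq_sqrt_inner GG BB real_sqrt_divide)
  have "(G - A) \<bullet> (B - A) / (norm (G - A) * norm (B - A)) = cos (pi / 6)"
    using s unfolding GB n cos_30 by (simp add: power2_eq_square field_simps)
  then show "angle G A B = pi / 6"
    by (simp add: angle_def arccos_cos)
qed

lemma equilateral_swap:
  assumes "equilateral A B C" shows "equilateral B A C"
proof -
  have "triangle B A C"
    using assms by (simp add: equilateral_def triangle_def insert_commute)
  moreover have "dist B A = dist A C" "dist A C = dist C B"
    using assms unfolding equilateral_def by (metis dist_commute)+
  ultimately show ?thesis by (simp add: equilateral_def)
qed

text \<open>A point lies in the part opposite the vertex of least weight: equal shares of all three
  vertices, each as large as that weight, merge into \<open>G\<close>.\<close>

lemma closed_triangle_centroid_subdivision: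
  fixes A B C :: point
  defines "G \<equiv> (1 / 3) *\<^sub>R (A + B + C)"
  shows "closed_triangle A B C =
    closed_triangle G A B \<union> closed_triangle G B C \<union> closed_triangle G C A"
proof (intro equalityI Un_least)
  have "(1 / 3) *\<^sub>R A + (1 / 3) *\<^sub>R B + (1 / 3) *\<^sub>R C \<in> closed_triangle A B C"
    unfolding closed_triangle_def convex_hull_3 by (intro CollectI exI [of _ "1 / 3"] conjI) simp_all
  then have "G \<in> closed_triangle A B C" by (simp add: G_def scaleR_add_right)
  moreover have "{A, B, C} \<subseteq> closed_triangle A B C"
    unfolding closed_triangle_def by (rule hull_subset)
  moreover have "convex (closed_triangle A B C)"
    by (simp add: closed_triangle_def)
  ultimately show "closed_triangle G A B \<subseteq> closed_triangle A B C" "closed_triangle G B C \<subseteq> closed_triangle A B C"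
    "closed_triangle G C A \<subseteq> closed_triangle A B C"
    by (auto intro!: closed_triangle_subset del: subsetI)
  have sub: "a *\<^sub>R A' + b *\<^sub>R B' + c *\<^sub>R C' \<in> closed_triangle G A' B'"
    if "0 \<le> c" "c \<le> a" "c \<le> b" "a + b + c = 1" "G = (1 / 3) *\<^sub>R (A' + B' + C')" for a b c A' B' C'
  proof -
    have "a *\<^sub>R A' + b *\<^sub>R B' + c *\<^sub>R C' = (3 * c) *\<^sub>R G + (a - c) *\<^sub>R A' + (b - c) *\<^sub>R B'"
      unfolding that(5) by (simp add: vec2_eq_iff algebra_simps)
    moreover have "3 * c + (a - c) + (b - c) = 1" "0 \<le> 3 * c" "0 \<le> a - c" "0 \<le> b - c"
      using that by auto
    ultimately show ?thesis
      unfolding closed_triangle_def convex_hull_3 by blast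
  qed
  show "closed_triangle A B C \<subseteq> closed_triangle G A B \<union> closed_triangle G B C \<union> closed_triangle G C A"
  proof
    fix x assume "x \<in> closed_triangle A B C"
    then obtain a b c where x: "x = a *\<^sub>R A + b *\<^sub>R B + c *\<^sub>R C" "0 \<le> a" "0 \<le> b" "0 \<le> c" "a + b + c = 1"
      unfolding closed_triangle_def convex_hull_3 by blast
    consider "c \<le> a" "c \<le> b" | "a \<le> b" "a \<le> c" | "b \<le> a" "b \<le> c" by linarith
    then show "x \<in> closed_triangle G A B \<union> closed_triangle G B C \<union> closed_triangle G C A"
    proof cases
      case 1
      then have "x \<in> closed_triangle G A B"
        unfolding x(1) using x by (intro sub) (auto simp: G_def)
      then show ?thesis by blast
    next
      case 2
      then have "b *\<^sub>R B + c *\<^sub>R C + a *\<^sub>R A \<in> closed_triangle G B C"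
        using x by (intro sub) (auto simp: G_def ac_simps)
      moreover have "b *\<^sub>R B + c *\<^sub>R C + a *\<^sub>R A = x" by (simp add: x(1))
      ultimately show ?thesis by simp
    next
      case 3
      then have "c *\<^sub>R C + a *\<^sub>R A + b *\<^sub>R B \<in> closed_triangle G C A"
        using x by (intro sub) (auto simp: G_def ac_simps)
      moreover have "c *\<^sub>R C + a *\<^sub>R A + b *\<^sub>R B = x" by (simp add: x(1))
      ultimately show ?thesis by simp
    qed
  qed
qed

lemma equilateral_trisection:
  fixes A B C :: point
  assumes "equilateral A B C"
  defines "G \<equiv> (1 / 3) *\<^sub>R (A + B + C)"
  shows "can_be_tiled 3 A B C (closed_triangle G A B)" "dist G A = dist G B" "angle G B A = pi / 6"
proof -
  have G: "G = (1 / 3) *\<^sub>R (B + C + A)" "G = (1 / 3) *\<^sub>R (C + A + B)" "G = (1 / 3) *\<^sub>R (B + A + C)"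
    by (simp_all add: G_def ac_simps)
  note e = assms(1) equilateral_rotate [OF assms(1)] equilateral_rotate [OF equilateral_rotate [OF assms(1)]]
  have tri: "triangle G A B"
    using centroid_equilateral [OF assms(1)] by (simp add: G_def)
  have sides: "dist B C = dist A B" "dist C A = dist A B"
    using assms(1) by (simp_all add: equilateral_def)
  have "(dist G A)\<^sup>2 = (dist A B)\<^sup>2 / 3" "(dist G B)\<^sup>2 = (dist A B)\<^sup>2 / 3" "(dist G C)\<^sup>2 = (dist A B)\<^sup>2 / 3"
    using centroid_equilateral(2) [OF e(1)] centroid_equilateral(2) [OF e(2)] centroid_equilateral(2) [OF e(3)]
    by (simp_all only: G_def [symmetric] G [symmetric] sides)
  then have dG: "dist G B = dist G A" "dist G C = dist G A"
    by (metis power2_eq_imp_eq zero_le_dist)+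
  then show "dist G A = dist G B" by simp
  show "angle G B A = pi / 6"
    using centroid_equilateral(3) [OF equilateral_swap [OF assms(1)]] unfolding G(3) .
  obtain b c where bc: "b \<bullet> (B - A) = 1" "b \<bullet> (C - A) = 0" "c \<bullet> (B - A) = 0" "c \<bullet> (C - A) = 1"
    "\<And>x. x = (b \<bullet> x) *\<^sub>R (B - A) + (c \<bullet> x) *\<^sub>R (C - A)"
    using triangle_dual_basis assms(1) unfolding equilateral_def by metis
  have bc': "b \<bullet> B = 1 + b \<bullet> A" "b \<bullet> C = b \<bullet> A" "c \<bullet> B = c \<bullet> A" "c \<bullet> C = 1 + c \<bullet> A"
    using bc(1-4) by (simp_all add: inner_diff_right)
  have bcG: "b \<bullet> G = 1 / 3 + b \<bullet> A" "c \<bullet> G = 1 / 3 + c \<bullet> A"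
    by (simp_all add: G_def inner_add_right bc')
  \<comment> \<open>Normals of the lines from \<open>G\<close> to \<open>B\<close>, \<open>A\<close>
    and \<open>C\<close>, in this order; each line separates the two parts that meet along
    it.\<close>
  have nz: "b + 2 *\<^sub>R c \<noteq> 0" "c - b \<noteq> 0" "2 *\<^sub>R b + c \<noteq> 0"
  proof -
    have "(b + 2 *\<^sub>R c) \<bullet> (B - A) = 1" "(c - b) \<bullet> (C - A) = 1" "(2 *\<^sub>R b + c) \<bullet> (C - A) = 1"
      unfolding inner_add_left inner_diff_left inner_scaleR_left bc by simp_all
    then show "b + 2 *\<^sub>R c \<noteq> 0" "c - b \<noteq> 0" "2 *\<^sub>R b + c \<noteq> 0" by auto
  qed
  let ?t1 = "closed_triangle G A B" and ?t2 = "closed_triangle G B C" and ?t3 = "closed_triangle G C A"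
  have d: "interior ?t1 \<inter> interior ?t2 = {}" "interior ?t1 \<inter> interior ?t3 = {}" "interior ?t3 \<inter> interior ?t2 = {}"
    by (rule closed_triangles_separated [where k = "1 + (b + 2 *\<^sub>R c) \<bullet> A", OF nz(1)]
            closed_triangles_separated [where k = "(c - b) \<bullet> A", OF nz(2)]
            closed_triangles_separated [where k = "1 + (2 *\<^sub>R b + c) \<bullet> A", OF nz(3)];
        unfold inner_add_left inner_diff_left inner_scaleR_left bc' bcG; simp)+
  show "can_be_tiled 3 A B C (closed_triangle G A B)"
  proof (rule can_be_tiled_indexed [where I = "{(A, B), (B, C), (C, A)}" and F = "\<lambda>(P, Q). closed_triangle G P Q"])
    show "interior (closed_triangle G A B) \<noteq> {}"
      using tri by (rule interior_closed_triangle_nonempty)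
    have "A \<noteq> B" "B \<noteq> C" "C \<noteq> A"
      using assms(1) triangle_distinct by (auto simp: equilateral_def)
    then show "3 = card {(A, B), (B, C), (C, A)}" by auto
    have "congruent_sets ?t2 ?t1" "congruent_sets ?t3 ?t1"
      using dG sides by (intro congruent_sets_sym [OF congruent_SSS [OF tri]]; simp)+
    moreover have "congruent_sets ?t1 ?t1" by (intro congruent_SSS [OF tri]) auto
    ultimately show "congruent_sets (case i of (P, Q) \<Rightarrow> closed_triangle G P Q) ?t1"
      if "i \<in> {(A, B), (B, C), (C, A)}" for i
      using that by auto
    show "interior (case i of (P, Q) \<Rightarrow> closed_triangle G P Q) \<inter>
      interior (case j of (P, Q) \<Rightarrow> closed_triangle G P Q) = {}"
      if "i \<in> {(A, B), (B, C), (C, A)}" "j \<in> {(A, B), (B, C), (C, A)}" "i \<noteq> j" for i j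
      using that d by (elim insertE emptyE; simp add: Int_commute)
    show "(\<Union>i\<in>{(A, B), (B, C), (C, A)}. case i of (P, Q) \<Rightarrow> closed_triangle G P Q) = closed_triangle A B C"
      unfolding closed_triangle_centroid_subdivision [of A B C, folded G_def] by auto
  qed simp
qed

section \<open>The grid of small triangles\<close>

lemma congruent_homothety:
  assumes "\<bar>d\<bar> = 1" "Q' - P' = d *\<^sub>R (Q - P)" "R' - P' = d *\<^sub>R (R - P)"
  shows "congruent_sets (closed_triangle P' Q' R') (closed_triangle P Q R)"
proof -
  \<comment> \<open>A translation if \<open>d = 1\<close>, and a point reflection if
    \<open>d = - 1\<close>; these produce the upward and the downward cells.\<close>
  define f where "f x = P' + d *\<^sub>R (x - P)" for x
  have iso: "dist (f x) (f y) = dist x y" for x y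
  proof -
    have "f x - f y = d *\<^sub>R (x - y)" by (simp add: f_def algebra_simps)
    then show ?thesis using assms(1) by (simp add: dist_norm)
  qed
  moreover have "f P = P'" "f Q = Q'" "f R = R'"
    unfolding f_def assms(2,3) [symmetric] by simp_all
  then have "f ` closed_triangle P Q R = closed_triangle P' Q' R'"
    using isometry_closed_triangle [OF iso] by simp
  ultimately have "congruent_sets (closed_triangle P Q R) (closed_triangle P' Q' R')"
    unfolding congruent_sets_def by blast
  then show ?thesis by (rule congruent_sets_sym)
qed

text \<open>In barycentric coordinates scaled to \<open>X, Y \<ge> 0\<close>, \<open>Z = X + Y \<le> m\<close>, the small triangles are the
  cells of the lines \<open>X, Y, Z \<in> \<int>\<close>. The index \<open>(i, j)\<close> stands for the upward cell in
  \<open>[i, i + 1] \<times> [j, j + 1]\<close> of the \<open>(X, Z)\<close>-plane if \<open>i \<le> j\<close>, and for the downward cell in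
  \<open>[j, j + 1] \<times> [i, i + 1]\<close> if \<open>j < i\<close>.\<close>

lemma quadratic_tiling:
  assumes tri: "triangle A B C" and m: "0 < m"
  shows "can_be_tiled (m\<^sup>2) A B C
    (closed_triangle A (A + (1 / of_nat m) *\<^sub>R (B - A)) (A + (1 / of_nat m) *\<^sub>R (C - A)))"
    (is "can_be_tiled _ A B C ?T")
proof -
  obtain b c where bc: "b \<bullet> (B - A) = 1" "b \<bullet> (C - A) = 0" "c \<bullet> (B - A) = 0" "c \<bullet> (C - A) = 1"
    "\<And>x. x = (b \<bullet> x) *\<^sub>R (B - A) + (c \<bullet> x) *\<^sub>R (C - A)"
    using triangle_dual_basis [OF tri] by metis
  define u v where "u = (1 / of_nat m) *\<^sub>R (B - A)" and "v = (1 / of_nat m) *\<^sub>R (C - A)"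
  \<comment> \<open>Rescaled so that \<open>X\<close> and \<open>Y\<close> below are measured in
    grid steps.\<close>
  define b' c' where "b' = of_nat m *\<^sub>R b" and "c' = of_nat m *\<^sub>R c"
  have bc': "b' \<bullet> u = 1" "b' \<bullet> v = 0" "c' \<bullet> u = 0" "c' \<bullet> v = 1"
    using m by (simp_all add: b'_def c'_def u_def v_def bc(1-4))
  have decomp: "x = (b' \<bullet> x) *\<^sub>R u + (c' \<bullet> x) *\<^sub>R v" for x
  proof -
    have "(b' \<bullet> x) *\<^sub>R u = (b \<bullet> x) *\<^sub>R (B - A)" "(c' \<bullet> x) *\<^sub>R v = (c \<bullet> x) *\<^sub>R (C - A)"
      using m by (simp_all add: b'_def c'_def u_def v_def)
    then show ?thesis using bc(5) [of x] by simp
  qed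
  define X Y Z where "X x = b' \<bullet> (x - A)" and "Y x = c' \<bullet> (x - A)" and "Z x = X x + Y x" for x
  have ABC: "closed_triangle A B C = {x. 0 \<le> X x \<and> 0 \<le> Y x \<and> Z x \<le> of_nat m}"
  proof -
    have "X x = of_nat m * (b \<bullet> (x - A))" "Y x = of_nat m * (c \<bullet> (x - A))" for x
      by (simp_all add: X_def Y_def b'_def c'_def)
    moreover have "of_nat m * s + of_nat m * t \<le> of_nat m \<longleftrightarrow> s + t \<le> 1" for s t :: real
      using m mult_le_cancel_left_pos [of "of_nat m" "s + t" 1] by (simp add: distrib_left)
    ultimately show ?thesis
      using m unfolding closed_triangle_dual_basis [OF bc] Z_def by (simp add: zero_le_mult_iff)
  qed
  define small where "small k l d =
      closed_triangle (A + k *\<^sub>R u + l *\<^sub>R v) (A + (k + d) *\<^sub>R u + l *\<^sub>R v) (A + k *\<^sub>R u + (l + d) *\<^sub>R v)"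
    for k l d :: real
  have small_cong: "congruent_sets (small k l d) ?T" if "\<bar>d\<bar> = 1" for k l d
    unfolding small_def u_def [symmetric] v_def [symmetric]
    by (rule congruent_homothety [OF that]) (simp_all add: algebra_simps)
  have small_iff: "x \<in> small k l d \<longleftrightarrow> 0 \<le> d * (X x - k) \<and> 0 \<le> d * (Y x - l) \<and> d * (X x - k) + d * (Y x - l) \<le> 1"
    if "\<bar>d\<bar> = 1" for x k l d
  proof -
    have dd: "d * d = 1" using that by (metis abs_mult_self_eq mult_1)
    have dsq: "d * s * d = s" for s
      using dd by (metis mult.assoc mult.commute mult_1)
    define O' where "O' = A + k *\<^sub>R u + l *\<^sub>R v"
    have e: "A + (k + d) *\<^sub>R u + l *\<^sub>R v - O' = d *\<^sub>R u" "A + k *\<^sub>R u + (l + d) *\<^sub>R v - O' = d *\<^sub>R v"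
      by (simp_all add: O'_def algebra_simps)
    have "small k l d = {x. 0 \<le> (d *\<^sub>R b') \<bullet> (x - O') \<and> 0 \<le> (d *\<^sub>R c') \<bullet> (x - O') \<and>
        (d *\<^sub>R b') \<bullet> (x - O') + (d *\<^sub>R c') \<bullet> (x - O') \<le> 1}"
      unfolding small_def O'_def [symmetric]
    proof (rule closed_triangle_dual_basis; unfold e)
      show "y = (d *\<^sub>R b' \<bullet> y) *\<^sub>R d *\<^sub>R u + (d *\<^sub>R c' \<bullet> y) *\<^sub>R d *\<^sub>R v" for y
        using decomp [of y] by (simp add: dsq)
    qed (simp_all add: bc' dd)
    moreover have "b' \<bullet> (x - O') = X x - k" "c' \<bullet> (x - O') = Y x - l"
      by (simp_all add: O'_def X_def Y_def inner_diff_right inner_add_right bc')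
    ultimately show ?thesis by simp
  qed
  \<comment> \<open>A downward cell is described from its corner with maximal \<open>X\<close> and
    \<open>Y\<close>, from which it extends in the negative directions; hence
    \<open>j + 1\<close>.\<close>
  define F :: "nat \<times> nat \<Rightarrow> point set" where
    "F = (\<lambda>(i, j). if i \<le> j then small (of_nat i) (of_nat (j - i)) 1 else small (of_nat (j + 1)) (of_nat (i - j)) (- 1))"
  have up: "x \<in> F (i, j) \<longleftrightarrow> of_nat i \<le> X x \<and> of_nat j - of_nat i \<le> Y x \<and> Z x \<le> of_nat j + 1" if "i \<le> j" for x i j
    using that small_iff [of 1] by (auto simp: F_def Z_def of_nat_diff)
  have down: "x \<in> F (i, j) \<longleftrightarrow> X x \<le> of_nat j + 1 \<and> Y x \<le> of_nat i - of_nat j \<and> of_nat i \<le> Z x" if "j < i" for x i j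
    using that small_iff [of "- 1"] by (auto simp: F_def Z_def of_nat_diff)
  have cell: "of_nat (min i j) \<le> X x" "X x \<le> of_nat (min i j) + 1" "of_nat (max i j) \<le> Z x" "Z x \<le> of_nat (max i j) + 1"
    if "x \<in> F (i, j)" for x i j
    using that up [of i j x] down [of j i x] unfolding Z_def by (cases "i \<le> j"; force)+
  have sep: "interior (F p) \<inter> interior (F q) = {}"
    if "n \<noteq> 0" "\<And>x. x \<in> F p \<Longrightarrow> n \<bullet> (x - A) \<le> k" "\<And>x. x \<in> F q \<Longrightarrow> k \<le> n \<bullet> (x - A)" for n k p q
    by (rule interiors_separated [OF that(1), of _ "k + n \<bullet> A"])
      (use that(2,3) in \<open>auto simp: inner_diff_right algebra_simps\<close>)
  have nz: "b' \<noteq> 0" "c' \<noteq> 0" "b' + c' \<noteq> 0"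
    using bc' inner_add_left [of b' c' u] by auto
  have Z: "Z x = (b' + c') \<bullet> (x - A)" for x
    by (simp add: Z_def X_def Y_def inner_add_left)
  \<comment> \<open>The minimum and maximum of the indices name the unit square of the cell.
    Different squares are separated by a line in \<open>X\<close> or \<open>Z\<close>, and the two
    cells of an off-diagonal square by a line in \<open>Y\<close>.\<close>
  have disj_lt: "interior (F (i, j)) \<inter> interior (F (k, l)) = {}"
    if "min i j < min k l \<or> max i j < max k l \<or> (i = l \<and> j = k \<and> k < l)" for i j k l
    using that
  proof (elim disjE conjE)
    assume "min i j < min k l"
    then have "real (min i j) + 1 \<le> real (min k l)" by linarith
    then show ?thesis
      using cell [of _ i j] cell [of _ k l] unfolding X_def
      by (intro sep [OF nz(1), of _ "real (min k l)"]) force+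
  next
    assume "max i j < max k l"
    then have "real (max i j) + 1 \<le> real (max k l)" by linarith
    then show ?thesis
      using cell [of _ i j] cell [of _ k l] unfolding Z
      by (intro sep [OF nz(3), of _ "real (max k l)"]) force+
  next
    assume "i = l" "j = k" "k < l"
    then show ?thesis
      using up [of k l] down [of k l] unfolding Y_def
      by (intro sep [OF nz(2), of _ "real l - real k"]) auto
  qed
  show ?thesis
  proof (rule can_be_tiled_indexed)
    show "finite ({..<m} \<times> {..<m})" "m\<^sup>2 = card ({..<m} \<times> {..<m})"
      by (simp_all add: card_cartesian_product power2_eq_square)
    show "congruent_sets (F p) ?T" if "p \<in> {..<m} \<times> {..<m}" for p
      using small_cong by (simp add: F_def split: prod.split)
    have "((1 / of_nat m) *\<^sub>R (B - A)) \<bullet> ((1 / of_nat m) *\<^sub>R (C - A)) = (B - A) \<bullet> (C - A) / (of_nat m)\<^sup>2" for B C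
      by (simp add: power2_eq_square)
    then have "triangle A (A + (1 / of_nat m) *\<^sub>R (B - A)) (A + (1 / of_nat m) *\<^sub>R (C - A))"
      using tri m unfolding triangle_iff_inner add_diff_cancel_left'
      by (simp add: power2_eq_square)
    then show "interior ?T \<noteq> {}" by (rule interior_closed_triangle_nonempty)
    show "interior (F p) \<inter> interior (F q) = {}" if "p \<noteq> q" for p q
    proof -
      obtain i j k l where pq: "p = (i, j)" "q = (k, l)" by (cases p, cases q)
      have "min i j < min k l \<or> max i j < max k l \<or> (i = l \<and> j = k \<and> k < l) \<or>
        min k l < min i j \<or> max k l < max i j \<or> (k = j \<and> l = i \<and> i < j)"
        using \<open>p \<noteq> q\<close> unfolding pq by (auto simp: min_def max_def split: if_splits)
      then show ?thesis
        using disj_lt [of i j k l] disj_lt [of k l i j] unfolding pq by (auto simp: Int_commute)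
    qed
    show "(\<Union>p\<in>{..<m} \<times> {..<m}. F p) = closed_triangle A B C"
    proof (intro equalityI subsetI)
      fix x assume "x \<in> (\<Union>p\<in>{..<m} \<times> {..<m}. F p)"
      then obtain i j where ij: "i < m" "j < m" "x \<in> F (i, j)" by auto
      have "real (max i j) + 1 \<le> real m" using ij by linarith
      moreover have "0 \<le> Y x"
      proof (cases "i \<le> j")
        case True
        then show ?thesis using ij(3) up [of i j x] by force
      next
        case False
        then have "real j + 1 \<le> real i" by linarith
        with False show ?thesis using ij(3) down [of j i x] unfolding Z_def by force
      qed
      ultimately show "x \<in> closed_triangle A B C"
        unfolding ABC using cell [OF ij(3)] by force
    next
      fix x assume "x \<in> closed_triangle A B C"
      then have x: "0 \<le> X x" "0 \<le> Y x" "Z x \<le> of_nat m" by (auto simp: ABC)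
      \<comment> \<open>The caps handle the side \<open>Z x = m\<close>, where the floors could
        point outside the grid.\<close>
      define j where "j = min (nat \<lfloor>Z x\<rfloor>) (m - 1)"
      define i where "i = min (nat \<lfloor>X x\<rfloor>) j"
      have "0 \<le> Z x" using x by (simp add: Z_def)
      have jm: "j < m" using m by (simp add: j_def)
      have i: "i \<le> j" "real i \<le> X x" using x(1) unfolding i_def by linarith+
      have j: "real j \<le> Z x" "Z x \<le> real j + 1"
        using \<open>0 \<le> Z x\<close> x(3) m unfolding j_def by linarith+
      have i': "X x \<le> real i + 1"
        using x(1,2) j(2) unfolding i_def Z_def by linarith
      \<comment> \<open>The square is now fixed, and \<open>Y\<close> decides between its upward and
        downward cell. On the diagonal \<open>i = j\<close> the condition \<open>0 \<le> Y x\<close>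
        already selects the upward one.\<close>
      show "x \<in> (\<Union>p\<in>{..<m} \<times> {..<m}. F p)"
      proof (cases "real j - real i \<le> Y x")
        case True
        then have "x \<in> F (i, j)" using up [OF i(1)] i j by simp
        then show ?thesis using i(1) jm by force
      next
        case False
        then have "i < j" using x(2) by linarith
        then have "x \<in> F (j, i)" using down [of i j x] False i' j by simp
        then show ?thesis using \<open>i < j\<close> jm by force
      qed
    qed
  qed
qed

section \<open>Shapes of the tiles and final assembly\<close>

lemma scaled_equilateral:
  assumes "equilateral A B C" "0 < t"
  shows "equilateral A (A + t *\<^sub>R (B - A)) (A + t *\<^sub>R (C - A))" (is "equilateral A ?B ?C")
proof -
  have "triangle A ?B ?C"
    using assms unfolding equilateral_def triangle_iff_inner by (simp add: power2_eq_square)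
  moreover have "?B - ?C = t *\<^sub>R (B - C)" by (simp add: algebra_simps)
  then have "dist ?B ?C = t * dist B C" using assms(2) by (simp add: dist_norm)
  moreover have "dist A ?B = t * dist A B" "dist ?C A = t * dist C A"
    using assms(2) by (simp_all add: dist_norm norm_minus_commute)
  ultimately show ?thesis using assms(1) by (simp add: equilateral_def)
qed

lemma right_tile_pi_sixth:
  assumes "triangle P Q R" "angle P R Q = pi / 2" "angle Q P R = pi / 6"
  shows "right_tile (closed_triangle P Q R) (pi / 6)"
proof -
  have "angle P Q R = pi / 3"
    using right_triangle_angles(1) [OF assms(1,2)] assms(3) by simp
  then have "tile_angles (closed_triangle P Q R) (pi / 6) (pi / 3) (pi / 2)"
    using assms unfolding tile_angles_def by auto
  then show ?thesis unfolding right_tile_def by blast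
qed

theorem theorem7:
  fixes A B C :: point and N :: nat
  assumes "equilateral A B C" and "N > 0"
  shows "((\<exists>m>0. N = 3 * m\<^sup>2) \<longrightarrow>
            (\<exists>T. isosceles_tile T (pi / 6) \<and> can_be_tiled N A B C T)) \<and>
         ((\<exists>m>0. N = 6 * m\<^sup>2 \<or> N = 2 * m\<^sup>2) \<longrightarrow>
            (\<exists>T. right_tile T (pi / 6) \<and> can_be_tiled N A B C T)) \<and>
         ((\<exists>m>0. N = m\<^sup>2) \<longrightarrow>
            (\<exists>T. similar_sets T (closed_triangle A B C) \<and> can_be_tiled N A B C T)) \<and>
         (\<forall>T \<alpha>. right_tile T \<alpha> \<and> \<alpha> \<noteq> pi / 6 \<longrightarrow> (\<forall>n. \<not> can_be_tiled n A B C T))"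
proof -
  have "triangle A B C" using assms(1) by (simp add: equilateral_def)
  {
    fix m :: nat
    assume m: "0 < m"
    define B' C' where "B' = A + (1 / of_nat m) *\<^sub>R (B - A)" and "C' = A + (1 / of_nat m) *\<^sub>R (C - A)"
    have eq: "equilateral A B' C'"
      unfolding B'_def C'_def using assms(1) m by (intro scaled_equilateral) simp_all
    have grid: "can_be_tiled (m\<^sup>2) A B C (closed_triangle A B' C')"
      unfolding B'_def C'_def by (rule quadratic_tiling [OF \<open>triangle A B C\<close> m])
    have tri: "triangle A B' C'" and AB_AC: "dist A B' = dist A C'"
      using eq by (simp_all add: equilateral_def dist_commute)
    define G where "G = (1 / 3) *\<^sub>R (A + B' + C')"
    note G = centroid_equilateral [OF eq, folded G_def] equilateral_trisection [OF eq, folded G_def]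
    have three: "can_be_tiled (m\<^sup>2 * 3) A B C (closed_triangle G A B')"
      using can_be_tiled_refine [OF grid G(4)] interior_closed_triangle_nonempty [OF G(1)] .
    have "\<exists>T. similar_sets T (closed_triangle A B C) \<and> can_be_tiled (m\<^sup>2) A B C T"
    proof -
      \<comment> \<open>The homothety centred at \<open>A\<close> that undoes the scaling by
        \<open>1 / m\<close>.\<close>
      define f where "f x = A + of_nat m *\<^sub>R (x - A)" for x
      have f: "f = (\<lambda>x. (A - of_nat m *\<^sub>R A) + of_nat m *\<^sub>R x)"
        by (auto simp: f_def algebra_simps)
      have "dist (f x) (f y) = of_nat m * dist x y" for x y
        by (simp add: f dist_norm flip: scaleR_diff_right)
      moreover have "f A = A" "f B' = B" "f C' = C"
        using m by (simp_all add: f_def B'_def C'_def)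
      then have "f ` closed_triangle A B' C' = closed_triangle A B C"
        unfolding closed_triangle_def f convex_hull_affinity [symmetric] by simp
      ultimately have "similar_sets (closed_triangle A B' C') (closed_triangle A B C)"
        using m unfolding similar_sets_def by (intro exI [of _ f] exI [of _ "of_nat m"]) simp
      with grid show ?thesis by blast
    qed
    moreover have "\<exists>T. isosceles_tile T (pi / 6) \<and> can_be_tiled (3 * m\<^sup>2) A B C T"
    proof -
      have "isosceles_tile (closed_triangle G A B') (pi / 6)"
        unfolding isosceles_tile_def using G by blast
      with three show ?thesis by (metis mult.commute)
    qed
    moreover have "\<exists>T. right_tile T (pi / 6) \<and> can_be_tiled (6 * m\<^sup>2) A B C T"
    proof -
      define M where "M = midpoint A B'"
      note H = isosceles_halving [OF G(1) G(5), folded M_def]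
      have "can_be_tiled (m\<^sup>2 * 3 * 2) A B C (closed_triangle G A M)"
        using can_be_tiled_refine [OF three H(1)] interior_closed_triangle_nonempty [OF H(2)] .
      \<comment> \<open>The angle \<open>pi / 6\<close> sits at the base vertex \<open>A\<close>,
        not at the apex \<open>G\<close>, so these two are listed in exchanged order.\<close>
      moreover have "right_tile (closed_triangle A G M) (pi / 6)"
        using H G(3) by (intro right_tile_pi_sixth) (simp_all add: angle_commute triangle_def insert_commute)
      moreover have "closed_triangle A G M = closed_triangle G A M"
        by (simp add: closed_triangle_def insert_commute)
      ultimately show ?thesis
        by (intro exI [of _ "closed_triangle G A M"]) (simp add: mult.commute)
    qed
    moreover have "\<exists>T. right_tile T (pi / 6) \<and> can_be_tiled (2 * m\<^sup>2) A B C T"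
    proof -
      define M where "M = midpoint B' C'"
      note H = isosceles_halving [OF tri AB_AC, folded M_def]
      have "can_be_tiled (m\<^sup>2 * 2) A B C (closed_triangle A B' M)"
        using can_be_tiled_refine [OF grid H(1)] interior_closed_triangle_nonempty [OF H(2)] .
      \<comment> \<open>Halving keeps the base angle \<open>pi / 3\<close>; its complement
        \<open>pi / 6\<close> remains at the apex.\<close>
      moreover have "angle A B' M = pi / 3"
        using H(4) equilateral_angle [OF equilateral_swap [OF eq]] by simp
      then have "angle B' A M = pi / 6"
        using right_triangle_angles(1) [OF H(2,3)] by simp
      with H have "right_tile (closed_triangle A B' M) (pi / 6)"
        by (intro right_tile_pi_sixth)
      ultimately show ?thesis by (metis mult.commute)
    qed
    ultimately have "(\<exists>T. similar_sets T (closed_triangle A B C) \<and> can_be_tiled (m\<^sup>2) A B C T) \<and>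
      (\<exists>T. isosceles_tile T (pi / 6) \<and> can_be_tiled (3 * m\<^sup>2) A B C T) \<and>
      (\<exists>T. right_tile T (pi / 6) \<and> can_be_tiled (6 * m\<^sup>2) A B C T) \<and>
      (\<exists>T. right_tile T (pi / 6) \<and> can_be_tiled (2 * m\<^sup>2) A B C T)"
      by blast
  }
  note tilings = this
  show ?thesis
    using tilings no_right_tiling_equilateral [OF assms(1)] by blast
qed

end
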